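(* Let $\mu = m(x)\,dx$ and $\nu = n(x)\,dx$ in $\mathcal{P}_2(\mathbb{R})$ have strictly positive densities $m,n$ with respect to Lebesgue measure and be in convex order, and let $f := k * (n-m)$, where $k(x) = x^+=\max\{x,0\}$. Then $f \ge 0$ and, setting $$\varrho_t := (1-t) \mu + t \nu,\qquad a_t := \frac{2f}{(1-t)m + t n},\qquad t \in [0,1],$$ the Fokker–Planck equation $\partial_t\varrho=\mathrm{Tr}(\frac12\nabla^2a\varrho)$ (i.e. $\partial_t\varrho=\frac12\partial_x^2(a\varrho)$) holds in $(0,1)\times\mathbb{R}$. Moreover, for any $p \ge 1$, $$\int_0^1 \int_{\mathbb{R}} |a_t|^p\, d \varrho_t\, d t \le 2^p\, \|n-m\|_{L^1}^{p-1} \int_{\mathbb{R}} |n(x)-m(x)| \left|\int_0^x M_{p}\left( m(y), n(y) \right) |y-x|^p\, d y\right| d x,$$ where, for $u,v >0$, $$M_p(u,v) := \int_0^1 ((1-t)u +tv)^{1-p}\,dt,$$ which for $u\neq v$ equals $\dfrac{ v^{2-p} - u^{2-p}}{(2-p)(v-u)}$ if $p \neq 2$ and $\dfrac{\log (v/u)}{v-u}$ if $p=2$.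
   Context: $\mathcal{P}_2(\mathbb{R})$ is the set of Borel probability measures on $\mathbb{R}$ with finite second moment, with the topology of narrow convergence together with convergence of second moments. $\mu,\nu$ are in convex order if $\int\varphi\,d\mu\le\int\varphi\,d\nu$ for every convex $\varphi:\mathbb{R}\to\mathbb{R}$. $*$ denotes convolution on $\mathbb{R}$. $C^{1,2}_b([0,1]\times\mathbb{R})$ is the space of continuous functions $\varphi(t,x)=\varphi_t(x)$ on $[0,1]\times\mathbb{R}$, continuously differentiable once in $t$ and twice in $x$ in $(0,1)\times\mathbb{R}$, with $\partial_t\varphi,\partial_x^2\varphi$ uniformly bounded. For a continuous curve $(\varrho_t)_{t\in[0,1]}\subseteq\mathcal{P}_2(\mathbb{R})$ and a Borel map $a:(0,1)\times\mathbb{R}\to[0,\infty)$, the Fokker–Planck equation holds in $(0,1)\times\mathbb{R}$ if $\int_0^1\int_{\mathbb{R}}|a_t|\,d\varrho_t\,dt<\infty$ and for every $\varphi\in C^{1,2}_b([0,1]\times\mathbb{R})$ $$\int_0^1 \int_{\mathbb{R}} \left( \partial_t \varphi + \tfrac12 a_t\, \partial_x^2 \varphi \right) d \varrho_t\, d t = \int_{\mathbb{R}} \varphi_1\, d \varrho_1 - \int_{\mathbb{R}} \varphi_0\, d \varrho_0.$$ *)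

theory Defs
  imports "HOL-Probability.Probability"
begin

definition P2 :: "real measure set" where
  "P2 = {\<mu>. prob_space \<mu> \<and> sets \<mu> = sets borel \<and> integrable \<mu> (\<lambda>x. x\<^sup>2)}"

text \<open>Narrow convergence together with convergence of second moments is the initial topology of
  the functionals \<open>\<mu> \<mapsto> \<integral> g d\<mu>\<close>, for \<open>g\<close> bounded and continuous, and \<open>\<mu> \<mapsto> \<integral> x\<^sup>2 d\<mu>\<close>.
  The choice of a constant \<open>g\<close> shows that its carrier is all of \<^term>\<open>P2\<close>.\<close>

definition P2_topology :: "real measure topology" where
  "P2_topology = topology_generated_by
     ({{\<mu> \<in> P2. (\<integral>x. g x \<partial>\<mu>) \<in> U} |g U.
         continuous_on UNIV (g :: real \<Rightarrow> real) \<and> bounded (range g) \<and> open (U :: real set)}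
      \<union> {{\<mu> \<in> P2. (\<integral>x. x\<^sup>2 \<partial>\<mu>) \<in> U} |U. open (U :: real set)})"

text \<open>A convex function need not be integrable with respect to a measure in \<^term>\<open>P2\<close>, but it is
  bounded below by an affine function, so its negative part is; its integral is therefore an
  element of \<open>(-\<infinity>, \<infinity>]\<close>, and the difference below is never \<open>\<infinity> - \<infinity>\<close> in that use.\<close>

definition extended_integral :: "'a measure \<Rightarrow> ('a \<Rightarrow> real) \<Rightarrow> ereal" where
  "extended_integral M g =
     enn2ereal (\<integral>\<^sup>+x. ennreal (g x) \<partial>M) - enn2ereal (\<integral>\<^sup>+x. ennreal (- g x) \<partial>M)"

definition convex_order :: "real measure \<Rightarrow> real measure \<Rightarrow> bool" where
  "convex_order \<mu> \<nu> \<longleftrightarrow>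
     (\<forall>\<phi>. convex_on UNIV \<phi> \<longrightarrow> extended_integral \<mu> \<phi> \<le> extended_integral \<nu> \<phi>)"

definition convol :: "(real \<Rightarrow> real) \<Rightarrow> (real \<Rightarrow> real) \<Rightarrow> real \<Rightarrow> real" where
  "convol g h x = (\<integral>y. g (x - y) * h y \<partial>lborel)"

text \<open>The measure \<open>(1 - t) \<mu> + t \<nu>\<close>, for \<open>t \<in> [0,1]\<close> and \<open>\<mu>\<close>, \<open>\<nu>\<close> with the same measurable sets.\<close>

definition mix_measure :: "real \<Rightarrow> 'a measure \<Rightarrow> 'a measure \<Rightarrow> 'a measure" where
  "mix_measure t \<mu> \<nu> = measure_of (space \<mu>) (sets \<mu>)
     (\<lambda>A. ennreal (1 - t) * emeasure \<mu> A + ennreal t * emeasure \<nu> A)"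

definition d_t :: "(real \<Rightarrow> real \<Rightarrow> real) \<Rightarrow> real \<Rightarrow> real \<Rightarrow> real" where
  "d_t \<phi> t x = deriv (\<lambda>s. \<phi> s x) t"

definition d_x :: "(real \<Rightarrow> real \<Rightarrow> real) \<Rightarrow> real \<Rightarrow> real \<Rightarrow> real" where
  "d_x \<phi> t x = deriv (\<lambda>y. \<phi> t y) x"

definition C12b :: "(real \<Rightarrow> real \<Rightarrow> real) set" where
  "C12b = {\<phi>.
     continuous_on ({0..1} \<times> UNIV) (\<lambda>(t, x). \<phi> t x) \<and>
     (\<forall>t\<in>{0<..<1}. \<forall>x. (\<lambda>s. \<phi> s x) field_differentiable at t) \<and>
     (\<forall>t\<in>{0<..<1}. \<forall>x. (\<lambda>y. \<phi> t y) field_differentiable at x) \<and>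
     (\<forall>t\<in>{0<..<1}. \<forall>x. (\<lambda>y. d_x \<phi> t y) field_differentiable at x) \<and>
     continuous_on ({0<..<1} \<times> UNIV) (\<lambda>(t, x). d_t \<phi> t x) \<and>
     continuous_on ({0<..<1} \<times> UNIV) (\<lambda>(t, x). d_x \<phi> t x) \<and>
     continuous_on ({0<..<1} \<times> UNIV) (\<lambda>(t, x). d_x (d_x \<phi>) t x) \<and>
     bounded ((\<lambda>(t, x). d_t \<phi> t x) ` ({0<..<1} \<times> UNIV)) \<and>
     bounded ((\<lambda>(t, x). d_x (d_x \<phi>) t x) ` ({0<..<1} \<times> UNIV))}"

text \<open>The first three conditions are the standing requirements on the data: \<open>\<rho>\<close> is a continuous
  curve in \<^term>\<open>P2\<close> and \<open>a\<close> is a nonnegative Borel map on \<open>(0,1) \<times> \<real>\<close>.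
  Values of \<open>\<rho>\<close> and \<open>a\<close> at other times are irrelevant.\<close>

definition fokker_planck :: "(real \<Rightarrow> real measure) \<Rightarrow> (real \<Rightarrow> real \<Rightarrow> real) \<Rightarrow> bool" where
  "fokker_planck \<rho> a \<longleftrightarrow>
     continuous_map (top_of_set {0..1}) P2_topology \<rho> \<and>
     (\<lambda>(t, x). a t x) \<in> borel_measurable (restrict_space borel ({0<..<1} \<times> UNIV)) \<and>
     (\<forall>t\<in>{0<..<1}. \<forall>x. 0 \<le> a t x) \<and>
     (\<integral>\<^sup>+t\<in>{0<..<1}. (\<integral>\<^sup>+x. ennreal \<bar>a t x\<bar> \<partial>\<rho> t) \<partial>lborel) < \<infinity> \<and>
     (\<forall>\<phi>\<in>C12b.
        (LBINT t:{0<..<1}. (\<integral>x. d_t \<phi> t x + 1/2 * a t x * d_x (d_x \<phi>) t x \<partial>\<rho> t))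
        = (\<integral>x. \<phi> 1 x \<partial>\<rho> 1) - (\<integral>x. \<phi> 0 x \<partial>\<rho> 0))"

definition Mp :: "real \<Rightarrow> real \<Rightarrow> real \<Rightarrow> real" where
  "Mp p u v = (LBINT t:{0..1}. ((1 - t) * u + t * v) powr (1 - p))"

text \<open>The oriented integral from \<open>c\<close> to \<open>d\<close> of a nonnegative function, which may be infinite.\<close>

definition oriented_integral :: "(real \<Rightarrow> ennreal) \<Rightarrow> real \<Rightarrow> real \<Rightarrow> ereal" where
  "oriented_integral g c d =
     (if c \<le> d then enn2ereal (\<integral>\<^sup>+y\<in>{c..d}. g y \<partial>lborel)
      else - enn2ereal (\<integral>\<^sup>+y\<in>{d..c}. g y \<partial>lborel))"

end

theory Submission
  imports Defs
begin

text \<open>Write \<open>h = n - m\<close>. Convex order, tested on \<open>\<plusminus>x\<close> and on \<open>y \<mapsto> (x - y)\<^sup>+\<close>, says that \<open>h\<close>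
  has vanishing zeroth and first moments and that \<open>f \<ge> 0\<close>. Let \<open>K x y\<close> be the kernel of Taylor's formula
  \<open>g y = g 0 + g' 0 * y + \<integral> K x y * g'' x dx\<close>. Since \<open>h\<close> annihilates affine functions,
  \<open>f x = \<integral> K x y * h y dy\<close>, and Fubini gives \<open>\<integral> f g'' = \<integral> g h\<close> for every \<open>g\<close> with bounded second
  derivative. As the density \<open>w\<close> of \<open>\<rho>\<close> has time derivative \<open>h\<close> and \<open>a w = 2 f\<close>, the integrand of
  the weak formulation is thus \<open>\<partial>\<^sub>t (\<phi> w)\<close>, which integrates to the boundary terms. For the \<open>L\<^sup>p\<close>
  bound, Jensen's inequality for the weight \<open>\<bar>h\<bar>\<close> gives
  \<open>f x powr p \<le> \<parallel>h\<parallel> powr (p - 1) * \<integral> K x y powr p * \<bar>h y\<bar> dy\<close>; Tonelli concludes.\<close>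

subsection \<open>The Taylor kernel and the potential\<close>

text \<open>For fixed \<open>y\<close> this is the distance \<open>\<bar>y - x\<bar>\<close> for
  \<open>x\<close> between \<open>0\<close> and \<open>y\<close> and zero elsewhere, up to the value
  at \<open>x = 0\<close>. It therefore has bounded support in \<open>x\<close>, unlike
  \<open>max (x - y) 0\<close>, which makes Fubini available.\<close>

definition taylor_kernel :: "real \<Rightarrow> real \<Rightarrow> real" where
  "taylor_kernel x y = (if 0 \<le> x then max (y - x) 0 else max (x - y) 0)"

lemma taylor_kernel_nonneg: "0 \<le> taylor_kernel x y"
  by (simp add: taylor_kernel_def)

lemma taylor_kernel_le: "taylor_kernel x y \<le> \<bar>x\<bar> + \<bar>y\<bar>"
  by (auto simp: taylor_kernel_def max_def)

lemma measurable_taylor_kernel [measurable]: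
  assumes [measurable]: "g \<in> borel_measurable M" "k \<in> borel_measurable M"
  shows "(\<lambda>z. taylor_kernel (g z) (k z)) \<in> borel_measurable M"
  unfolding taylor_kernel_def by measurable

text \<open>On \<open>{0..y}\<close> the function \<open>(y - x) * g' x + g x\<close> is a primitive
  of \<open>(y - x) * g'' x\<close>, so the fundamental theorem replaces an integration by parts.
  For \<open>y < 0\<close> the orientation is reversed and the kernel absorbs the sign.\<close>

lemma has_bochner_integral_taylor_kernel:
  fixes g g' g'' :: "real \<Rightarrow> real"
  assumes g: "\<And>x. (g has_real_derivative g' x) (at x)"
    and g': "\<And>x. (g' has_real_derivative g'' x) (at x)"
    and g'': "continuous_on UNIV g''"
  shows "has_bochner_integral lborel (\<lambda>x. taylor_kernel x y * g'' x) (g y - g 0 - g' 0 * y)"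
proof (cases "0 \<le> y")
  case True
  have "has_bochner_integral lborel (\<lambda>x. ((y - x) * g'' x) * indicator {0..y} x)
      ((y - y) * g' y + g y - ((y - 0) * g' 0 + g 0))"
  proof (rule has_bochner_integral_FTC_Icc_real[OF True])
    show "((\<lambda>x. (y - x) * g' x + g x) has_real_derivative (y - x) * g'' x) (at x)" for x
      by (auto intro!: derivative_eq_intros g g')
    show "isCont (\<lambda>x. (y - x) * g'' x) x" for x
      using g'' by (auto intro!: continuous_intros simp: continuous_on_eq_continuous_at)
  qed
  moreover have "(\<lambda>x. ((y - x) * g'' x) * indicator {0..y} x) = (\<lambda>x. taylor_kernel x y * g'' x)"
    using True by (auto simp: taylor_kernel_def indicator_def fun_eq_iff)
  ultimately show ?thesis by (simp add: algebra_simps)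
next
  case False
  then have "y \<le> 0" by simp
  have *: "has_bochner_integral lborel (\<lambda>x. ((x - y) * g'' x) * indicator {y..0} x)
      ((0 - y) * g' 0 - g 0 - ((y - y) * g' y - g y))"
  proof (rule has_bochner_integral_FTC_Icc_real[OF \<open>y \<le> 0\<close>])
    show "((\<lambda>x. (x - y) * g' x - g x) has_real_derivative (x - y) * g'' x) (at x)" for x
      by (auto intro!: derivative_eq_intros g g')
    show "isCont (\<lambda>x. (x - y) * g'' x) x" for x
      using g'' by (auto intro!: continuous_intros simp: continuous_on_eq_continuous_at)
  qed
  have [measurable]: "g'' \<in> borel_measurable borel"
    using g'' by (rule borel_measurable_continuous_onI)
  \<comment> \<open>At \<open>x = 0\<close> the kernel takes the branch
    \<open>max (y - x) 0\<close>, while the indicator of \<open>{y..0}\<close> still counts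
    \<open>x - y\<close>; the two integrands agree off this null set.\<close>
  have "AE x in lborel. x \<noteq> (0::real)" by (rule AE_lborel_singleton)
  then have "AE x in lborel. ((x - y) * g'' x) * indicator {y..0} x = taylor_kernel x y * g'' x"
    by eventually_elim (use False in \<open>auto simp: taylor_kernel_def indicator_def\<close>)
  with * have "has_bochner_integral lborel (\<lambda>x. taylor_kernel x y * g'' x)
      ((0 - y) * g' 0 - g 0 - ((y - y) * g' y - g y))"
    by (subst (asm) has_bochner_integral_cong_AE) auto
  then show ?thesis by (simp add: algebra_simps)
qed

text \<open>Taylor's formula for \<open>x\<^sup>2 / 2\<close>, whose second derivative is
  \<open>1\<close>. This total mass in \<open>x\<close> is the reason why a finite second moment of
  the density suffices for Fubini later.\<close>

lemma has_bochner_integral_taylor_kernel_quadratic: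
  "has_bochner_integral lborel (\<lambda>x. taylor_kernel x y) (y\<^sup>2 / 2)"
proof -
  have "((\<lambda>x. x\<^sup>2 / 2) has_real_derivative x) (at x)" for x :: real
    by (auto intro!: derivative_eq_intros)
  then show ?thesis
    using has_bochner_integral_taylor_kernel[of "\<lambda>x. x\<^sup>2 / 2" "\<lambda>x. x" "\<lambda>x. 1" y] by simp
qed

section \<open>Quadratic growth and integrability\<close>

lemma abs_le_one_plus_square: "\<bar>x\<bar> \<le> 1 + (x::real)\<^sup>2"
proof -
  have "0 \<le> (\<bar>x\<bar> - 1)\<^sup>2" by simp
  then show ?thesis by (simp add: power2_diff)
qed

text \<open>The Taylor remainder is at most \<open>B\<close> times the kernel mass
  \<open>y\<^sup>2 / 2\<close>, and \<open>\<bar>y\<bar> \<le> 1 + y\<^sup>2\<close> absorbs the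
  linear term.\<close>

lemma quadratic_growth:
  fixes g g' g'' :: "real \<Rightarrow> real"
  assumes "\<And>x. (g has_real_derivative g' x) (at x)"
    and "\<And>x. (g' has_real_derivative g'' x) (at x)"
    and "continuous_on UNIV g''" and B: "\<And>x. \<bar>g'' x\<bar> \<le> B"
  shows "\<bar>g y\<bar> \<le> (\<bar>g 0\<bar> + \<bar>g' 0\<bar> + B) * (1 + y\<^sup>2)"
proof -
  note T = has_bochner_integral_taylor_kernel[OF assms(1-3), of y]
  note Q = has_bochner_integral_taylor_kernel_quadratic[of y]
  have "\<bar>g y - g 0 - g' 0 * y\<bar> = \<bar>\<integral>x. taylor_kernel x y * g'' x \<partial>lborel\<bar>"
    using T by (simp add: has_bochner_integral_iff)
  also have "\<dots> \<le> (\<integral>x. taylor_kernel x y * B \<partial>lborel)"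
  proof (rule integral_abs_bound[THEN order_trans], rule integral_mono)
    show "integrable lborel (\<lambda>x. \<bar>taylor_kernel x y * g'' x\<bar>)"
      using T by (simp add: has_bochner_integral_iff)
    show "integrable lborel (\<lambda>x. taylor_kernel x y * B)"
      using Q by (simp add: has_bochner_integral_iff)
    show "\<bar>taylor_kernel x y * g'' x\<bar> \<le> taylor_kernel x y * B" for x
      using B[of x] taylor_kernel_nonneg[of x y] by (simp add: abs_mult mult_left_mono)
  qed
  also have "\<dots> = y\<^sup>2 / 2 * B"
    using Q by (simp add: has_bochner_integral_iff)
  finally have 1: "\<bar>g y\<bar> \<le> \<bar>g 0\<bar> + \<bar>g' 0\<bar> * \<bar>y\<bar> + y\<^sup>2 / 2 * B"
    unfolding abs_mult[symmetric] by linarith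
  have "0 \<le> B" using B[of 0] by linarith
  note y = abs_le_one_plus_square[of y]
  have "\<bar>g 0\<bar> \<le> \<bar>g 0\<bar> * (1 + y\<^sup>2)" "y\<^sup>2 / 2 * B \<le> B * (1 + y\<^sup>2)"
    "\<bar>g' 0\<bar> * \<bar>y\<bar> \<le> \<bar>g' 0\<bar> * (1 + y\<^sup>2)"
    using \<open>0 \<le> B\<close> mult_left_mono[OF y abs_ge_zero[of "g' 0"]] by (auto simp: algebra_simps)
  with 1 show ?thesis unfolding distrib_right[of _ B] distrib_right[of _ "\<bar>g' 0\<bar>"] by linarith
qed

text \<open>The density \<open>h\<close> may change sign, so the majorant is built from
  \<open>\<bar>h x\<bar>\<close>; this covers \<open>m\<close>, \<open>n\<close> and
  \<open>n - m\<close> alike.\<close>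

lemma integrable_quadratic_growth:
  fixes g h :: "real \<Rightarrow> real"
  assumes [measurable]: "g \<in> borel_measurable borel" "h \<in> borel_measurable borel"
    and "integrable lborel h" "integrable lborel (\<lambda>x. x\<^sup>2 * h x)"
    and C: "\<And>x. \<bar>g x\<bar> \<le> C * (1 + x\<^sup>2)"
  shows "integrable lborel (\<lambda>x. g x * h x)"
proof (rule Bochner_Integration.integrable_bound)
  show "integrable lborel (\<lambda>x. C * (\<bar>h x\<bar> + \<bar>x\<^sup>2 * h x\<bar>))"
    using assms by (intro integrable_mult_right Bochner_Integration.integrable_add integrable_abs)
  show "AE x in lborel. norm (g x * h x) \<le> norm (C * (\<bar>h x\<bar> + \<bar>x\<^sup>2 * h x\<bar>))"
  proof (intro always_eventually allI)
    fix x
    have "norm (g x * h x) \<le> (C * (1 + x\<^sup>2)) * \<bar>h x\<bar>"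
      unfolding real_norm_def abs_mult using C[of x] by (intro mult_right_mono) auto
    also have "\<dots> = C * (\<bar>h x\<bar> + \<bar>x\<^sup>2 * h x\<bar>)"
      by (simp add: abs_mult algebra_simps)
    finally show "norm (g x * h x) \<le> norm (C * (\<bar>h x\<bar> + \<bar>x\<^sup>2 * h x\<bar>))" by simp
  qed
qed measurable

section \<open>The potential of a density that annihilates affine functions\<close>

locale balanced_density =
  fixes h :: "real \<Rightarrow> real"
  assumes h_borel [measurable]: "h \<in> borel_measurable borel"
    and h_integrable: "integrable lborel h"
    and h_second_moment: "integrable lborel (\<lambda>x. x\<^sup>2 * h x)"
    and h_mass: "(\<integral>x. h x \<partial>lborel) = 0"
    and h_mean: "(\<integral>x. x * h x \<partial>lborel) = 0"
begin

abbreviation potential :: "real \<Rightarrow> real" where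
  "potential \<equiv> convol (\<lambda>x. max x 0) h"

lemma h_first_moment: "integrable lborel (\<lambda>x. x * h x)"
  by (rule integrable_quadratic_growth[OF _ _ h_integrable h_second_moment, of _ 1])
    (auto simp: abs_le_one_plus_square)

text \<open>Made for sections of the kernels at fixed \<open>x\<close>; there
  \<open>\<bar>x\<bar> + \<bar>y\<bar>\<close> is at most
  \<open>(1 + \<bar>x\<bar>) * (1 + y\<^sup>2)\<close>.\<close>

lemma integrable_linear_growth:
  assumes [measurable]: "g \<in> borel_measurable borel" and C: "\<And>y. \<bar>g y\<bar> \<le> \<bar>x\<bar> + \<bar>y\<bar>"
  shows "integrable lborel (\<lambda>y. g y * h y)"
proof (rule integrable_quadratic_growth[OF _ _ h_integrable h_second_moment])
  fix y
  have "\<bar>x\<bar> \<le> \<bar>x\<bar> * (1 + y\<^sup>2)" by (simp add: algebra_simps)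
  then show "\<bar>g y\<bar> \<le> (1 + \<bar>x\<bar>) * (1 + y\<^sup>2)"
    using C[of y] abs_le_one_plus_square[of y] unfolding distrib_right mult_1 by linarith
qed measurable

lemma taylor_kernel_integrable: "integrable lborel (\<lambda>y. taylor_kernel x y * h y)"
  by (rule integrable_linear_growth[of _ x])
    (auto simp: taylor_kernel_le taylor_kernel_nonneg abs_of_nonneg)

text \<open>The two branches of the kernel differ by the affine function \<open>y - x\<close>, which \<open>h\<close> annihilates.\<close>

lemma potential_eq_taylor_kernel: "potential x = (\<integral>y. taylor_kernel x y * h y \<partial>lborel)"
proof (cases "0 \<le> x")
  case True
  have 1: "integrable lborel (\<lambda>y. max (x - y) 0 * h y)"
    by (rule integrable_linear_growth[of _ x]) auto
  have "(\<integral>y. taylor_kernel x y * h y \<partial>lborel)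
      = (\<integral>y. max (x - y) 0 * h y + (y * h y - x * h y) \<partial>lborel)"
    using True by (intro Bochner_Integration.integral_cong)
      (auto simp: taylor_kernel_def max_def algebra_simps)
  also have "\<dots> = potential x"
    using 1 h_integrable h_first_moment by (simp add: convol_def h_mass h_mean)
  finally show ?thesis by simp
qed (simp add: taylor_kernel_def convol_def)

lemma potential_borel [measurable]: "potential \<in> borel_measurable borel"
  unfolding potential_eq_taylor_kernel[abs_def] by measurable

text \<open>Integrating \<open>\<bar>taylor_kernel x y * h y\<bar>\<close> first in \<open>x\<close>
  leaves \<open>y\<^sup>2 / 2 * \<bar>h y\<bar>\<close>, which is integrable by the second moment
  condition; the bounded factor \<open>g\<close> costs only a constant.\<close>

lemma integrable_pair_taylor_kernel:
  fixes g :: "real \<Rightarrow> real"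
  assumes [measurable]: "g \<in> borel_measurable borel" and B: "\<And>x. \<bar>g x\<bar> \<le> B"
  shows "integrable (lborel \<Otimes>\<^sub>M lborel) (\<lambda>(y, x). taylor_kernel x y * h y * g x)"
proof (rule Bochner_Integration.integrable_bound)
  have K: "integrable lborel (\<lambda>x. taylor_kernel x y)" for y
    using has_bochner_integral_taylor_kernel_quadratic[of y] by (simp add: has_bochner_integral_iff)
  have "integrable lborel (\<lambda>y. \<bar>y\<^sup>2 * h y\<bar> / 2)"
    using h_second_moment by simp
  also have "(\<lambda>y. \<bar>y\<^sup>2 * h y\<bar> / 2) = (\<lambda>y. \<integral>x. norm (taylor_kernel x y * h y) \<partial>lborel)"
    by (simp add: abs_mult taylor_kernel_nonneg
        has_bochner_integral_integral_eq[OF has_bochner_integral_taylor_kernel_quadratic])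
  finally have "integrable (lborel \<Otimes>\<^sub>M lborel) (\<lambda>(y, x). taylor_kernel x y * h y)"
    by (intro lborel_pair.Fubini_integrable) (auto simp: K)
  then show "integrable (lborel \<Otimes>\<^sub>M lborel) (\<lambda>z. B * (case z of (y, x) \<Rightarrow> taylor_kernel x y * h y))"
    by simp
  show "AE z in lborel \<Otimes>\<^sub>M lborel. norm (case z of (y, x) \<Rightarrow> taylor_kernel x y * h y * g x)
      \<le> norm (B * (case z of (y, x) \<Rightarrow> taylor_kernel x y * h y))"
  proof (intro always_eventually allI, clarify)
    fix y x
    have "\<bar>g x\<bar> \<le> \<bar>B\<bar>" using B[of x] by linarith
    then show "norm (taylor_kernel x y * h y * g x) \<le> norm (B * (taylor_kernel x y * h y))"
      by (simp add: abs_mult mult.commute mult_right_mono)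
  qed
qed measurable

text \<open>The case \<open>g = 1\<close> of the joint integrability, integrated in
  \<open>y\<close>. It is what makes the total integral of the coefficient finite.\<close>

lemma potential_integrable: "integrable lborel potential"
  using lborel_pair.integrable_snd[OF integrable_pair_taylor_kernel[of "\<lambda>x. 1" 1]]
  by (simp add: potential_eq_taylor_kernel[abs_def])

text \<open>The potential has second derivative \<open>h\<close> in the weak sense, here tested on
  functions of quadratic growth instead of compactly supported ones. After Fubini the inner integral
  is the remainder in Taylor's formula for \<open>g\<close>.\<close>

lemma integral_potential_second_derivative:
  fixes g g' g'' :: "real \<Rightarrow> real"
  assumes g: "\<And>x. (g has_real_derivative g' x) (at x)"
    and g': "\<And>x. (g' has_real_derivative g'' x) (at x)"
    and g'': "continuous_on UNIV g''" and B: "\<And>x. \<bar>g'' x\<bar> \<le> B"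
  shows "(\<integral>x. potential x * g'' x \<partial>lborel) = (\<integral>x. g x * h x \<partial>lborel)"
proof -
  have [measurable]: "g'' \<in> borel_measurable borel"
    using g'' by (rule borel_measurable_continuous_onI)
  have "continuous_on UNIV g"
    using g by (meson DERIV_isCont continuous_at_imp_continuous_on)
  then have [measurable]: "g \<in> borel_measurable borel"
    by (rule borel_measurable_continuous_onI)
  have gh: "integrable lborel (\<lambda>y. g y * h y)"
    by (rule integrable_quadratic_growth[OF _ _ h_integrable h_second_moment
          quadratic_growth[OF g g' g'' B]]) auto
  have "(\<integral>x. potential x * g'' x \<partial>lborel)
      = (\<integral>x. (\<integral>y. taylor_kernel x y * h y * g'' x \<partial>lborel) \<partial>lborel)"
    by (simp add: potential_eq_taylor_kernel)
  also have "\<dots> = (\<integral>y. (\<integral>x. taylor_kernel x y * h y * g'' x \<partial>lborel) \<partial>lborel)"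
    by (rule lborel_pair.Fubini_integral) (rule integrable_pair_taylor_kernel[OF _ B], measurable)
  also have "\<dots> = (\<integral>y. h y * (g y - g 0 - g' 0 * y) \<partial>lborel)"
  proof (rule Bochner_Integration.integral_cong)
    fix y
    have "(\<integral>x. taylor_kernel x y * h y * g'' x \<partial>lborel)
        = (\<integral>x. h y * (taylor_kernel x y * g'' x) \<partial>lborel)"
      by (simp add: mult_ac)
    also have "\<dots> = h y * (g y - g 0 - g' 0 * y)"
      using has_bochner_integral_taylor_kernel[OF g g' g'', of y]
      by (simp add: has_bochner_integral_iff)
    finally show "(\<integral>x. taylor_kernel x y * h y * g'' x \<partial>lborel) = h y * (g y - g 0 - g' 0 * y)" .
  qed simp
  also have "\<dots> = (\<integral>y. g y * h y - g 0 * h y - g' 0 * (y * h y) \<partial>lborel)"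
    by (simp add: algebra_simps)
  \<comment> \<open>The affine part of \<open>g\<close> drops out because \<open>h\<close> has
    neither mass nor mean.\<close>
  also have "\<dots> = (\<integral>y. g y * h y \<partial>lborel)"
    using gh h_integrable h_first_moment by (simp add: h_mass h_mean)
  finally show ?thesis .
qed

end

subsection \<open>Jensen's inequality and the mean \<open>M\<^sub>p\<close>\<close>

text \<open>Convexity gives this for \<open>s > 0\<close>. At \<open>s = 0\<close> the tangent has
  the value \<open>(1 - p) * c powr p\<close>, which is at most \<open>0 = 0 powr p\<close>.\<close>

lemma powr_above_tangent:
  fixes s c p :: real
  assumes "0 \<le> s" "0 < c" "1 \<le> p"
  shows "c powr p + p * c powr (p - 1) * (s - c) \<le> s powr p"
proof (cases "s = 0")
  case True
  have "c powr (p - 1) * c = c powr p"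
    using \<open>0 < c\<close> by (simp add: powr_diff)
  then have "c powr p + p * c powr (p - 1) * (s - c) = (1 - p) * c powr p"
    using True by (simp add: algebra_simps)
  also have "\<dots> \<le> 0" using \<open>1 \<le> p\<close> by (simp add: mult_nonpos_nonneg)
  finally show ?thesis using True by simp
next
  case False
  have "s powr p - c powr p \<ge> p * c powr (p - 1) * (s - c)"
    using False assms by (intro convex_on_imp_above_tangent[OF powr_convex[of p]])
      (auto simp: interior_open intro!: derivative_eq_intros)
  then show ?thesis by simp
qed

text \<open>Jensen's inequality for the finite weight \<open>\<bar>h\<bar>\<close>, not normalized,
  which produces the factor with exponent \<open>p - 1\<close>. The right-hand side lives in
  \<open>ennreal\<close>, so the \<open>p\<close>-th power of \<open>k\<close> may fail to be
  integrable.\<close>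

lemma powr_integral_le:
  fixes k h :: "'a \<Rightarrow> real"
  assumes [measurable]: "k \<in> borel_measurable M" and h: "integrable M h"
    and kh: "integrable M (\<lambda>y. k y * h y)" and k: "\<And>y. 0 \<le> k y" and p: "1 \<le> p"
  shows "ennreal (\<bar>\<integral>y. k y * h y \<partial>M\<bar> powr p)
    \<le> ennreal ((\<integral>y. \<bar>h y\<bar> \<partial>M) powr (p - 1)) * (\<integral>\<^sup>+y. ennreal (k y powr p * \<bar>h y\<bar>) \<partial>M)"
proof -
  define H where "H = (\<integral>y. \<bar>h y\<bar> \<partial>M)"
  define J where "J = (\<integral>y. k y * \<bar>h y\<bar> \<partial>M)"
  have [measurable]: "h \<in> borel_measurable M" using h by simp
  have "0 \<le> H" "0 \<le> J" unfolding H_def J_def using k by simp_all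
  have J: "integrable M (\<lambda>y. k y * \<bar>h y\<bar>)"
    using integrable_abs[OF kh] k by (simp add: abs_mult)
  have "\<bar>\<integral>y. k y * h y \<partial>M\<bar> \<le> J"
    unfolding J_def using integral_abs_bound[of M "\<lambda>y. k y * h y"] k by (simp add: abs_mult)
  then have le_J: "\<bar>\<integral>y. k y * h y \<partial>M\<bar> powr p \<le> J powr p"
    using p by (intro powr_mono2) auto
  show ?thesis
  proof (cases "J = 0")
    case True
    \<comment> \<open>Since \<open>0 powr p = 0\<close>, the left-hand side vanishes.\<close>
    with le_J show ?thesis by simp
  next
    case False
    then have "0 < J" using \<open>0 \<le> J\<close> by simp
    have "H \<noteq> 0"
    proof
      assume "H = 0"
      then have "AE y in M. \<bar>h y\<bar> = 0"
        unfolding H_def using h by (subst (asm) integral_nonneg_eq_0_iff_AE) auto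
      then have "J = 0" unfolding J_def by (intro integral_eq_zero_AE) auto
      with False show False by simp
    qed
    then have "0 < H" using \<open>0 \<le> H\<close> by simp
    \<comment> \<open>The mean of \<open>k\<close> under the normalized weight: the point at which
      the tangent is taken.\<close>
    define c where "c = J / H"
    have "0 < c" using \<open>0 < J\<close> \<open>0 < H\<close> by (simp add: c_def)
    show ?thesis
    proof (cases "integrable M (\<lambda>y. k y powr p * \<bar>h y\<bar>)")
      case True
      \<comment> \<open>The linear part of the tangent integrates to zero because
        \<open>c * H = J\<close>.\<close>
      have "c powr p * H
          = (\<integral>y. c powr p * \<bar>h y\<bar> + p * c powr (p - 1) * (k y * \<bar>h y\<bar> - c * \<bar>h y\<bar>) \<partial>M)"
        using J h \<open>0 < H\<close> by (simp add: H_def[symmetric] J_def[symmetric] c_def)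
      also have "\<dots> \<le> (\<integral>y. k y powr p * \<bar>h y\<bar> \<partial>M)"
      proof (rule integral_mono)
        show "integrable M (\<lambda>y. c powr p * \<bar>h y\<bar> + p * c powr (p - 1) * (k y * \<bar>h y\<bar> - c * \<bar>h y\<bar>))"
          using J h by auto
        fix y
        have "(c powr p + p * c powr (p - 1) * (k y - c)) * \<bar>h y\<bar> \<le> k y powr p * \<bar>h y\<bar>"
          by (intro mult_right_mono powr_above_tangent k p \<open>0 < c\<close>) simp
        then show "c powr p * \<bar>h y\<bar> + p * c powr (p - 1) * (k y * \<bar>h y\<bar> - c * \<bar>h y\<bar>)
            \<le> k y powr p * \<bar>h y\<bar>"
          by (simp add: algebra_simps)
      qed (rule True)
      finally have 1: "c powr p * H \<le> (\<integral>y. k y powr p * \<bar>h y\<bar> \<partial>M)" .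
      have "J powr p = H powr (p - 1) * (c powr p * H)"
        using \<open>0 < J\<close> \<open>0 < H\<close> by (simp add: c_def powr_divide powr_diff)
      also have "\<dots> \<le> H powr (p - 1) * (\<integral>y. k y powr p * \<bar>h y\<bar> \<partial>M)"
        using 1 by (intro mult_left_mono) auto
      finally have "\<bar>\<integral>y. k y * h y \<partial>M\<bar> powr p
          \<le> H powr (p - 1) * (\<integral>y. k y powr p * \<bar>h y\<bar> \<partial>M)"
        using le_J by simp
      then have "ennreal (\<bar>\<integral>y. k y * h y \<partial>M\<bar> powr p)
          \<le> ennreal (H powr (p - 1)) * ennreal (\<integral>y. k y powr p * \<bar>h y\<bar> \<partial>M)"
        by (simp add: ennreal_mult'[symmetric] ennreal_leI)
      then show ?thesis
        using True by (subst nn_integral_eq_integral) (auto simp: H_def)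
    next
      case False
      then have "(\<integral>\<^sup>+y. ennreal (k y powr p * \<bar>h y\<bar>) \<partial>M) = \<infinity>"
        by (subst (asm) integrable_iff_bounded) (auto simp: abs_mult not_less top_unique)
      \<comment> \<open>Positivity matters: in \<open>ennreal\<close> a factor \<open>0\<close>
        would turn \<open>\<infinity>\<close> into \<open>0\<close>.\<close>
      moreover have "0 < H powr (p - 1)" using \<open>0 < H\<close> by simp
      ultimately show ?thesis
        using \<open>0 < H\<close> by (simp add: H_def[symmetric] ennreal_mult_top ennreal_eq_0_iff del: powr_gt_zero)
    qed
  qed
qed

section \<open>The mean \<open>Mp\<close>\<close>

lemma interpolation_pos: "0 < u \<Longrightarrow> 0 < v \<Longrightarrow> t \<in> {0..1} \<Longrightarrow> 0 < (1 - t) * u + t * (v::real)"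
  by (cases "t = 0") (auto intro!: add_nonneg_pos mult_pos_pos)

lemma continuous_on_interpolation_powr:
  fixes u v q :: real
  assumes "0 < u" "0 < v"
  shows "continuous_on {0..1} (\<lambda>t. ((1 - t) * u + t * v) powr q)"
  using interpolation_pos[OF assms]
  by (intro continuous_intros) (auto simp: less_le)

text \<open>For positive \<open>u\<close> and \<open>v\<close> the integrand is continuous on the
  compact interval, so the Bochner integral in \<open>Mp\<close> is a genuine value and not the
  default \<open>0\<close>. Enlarging the open interval to the closed one gives the inequality,
  which suffices for the upper bound.\<close>

lemma nn_integral_interpolation_powr:
  assumes "0 < u" "0 < v"
  shows "(\<integral>\<^sup>+t\<in>{0<..<1}. ennreal (((1 - t) * u + t * v) powr (1 - p)) \<partial>lborel) \<le> ennreal (Mp p u v)"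
proof -
  have "set_integrable lborel {0..1} (\<lambda>t. ((1 - t) * u + t * v) powr (1 - p))"
    by (intro borel_integrable_atLeastAtMost' continuous_on_interpolation_powr assms)
  then have "(\<integral>\<^sup>+t\<in>{0..1}. ennreal (((1 - t) * u + t * v) powr (1 - p)) \<partial>lborel) = ennreal (Mp p u v)"
    unfolding Mp_def set_lebesgue_integral_def set_integrable_def
    by (subst nn_integral_eq_integral[symmetric])
      (auto intro!: nn_integral_cong simp: indicator_def)
  moreover have "(\<integral>\<^sup>+t\<in>{0<..<1}. ennreal (((1 - t) * u + t * v) powr (1 - p)) \<partial>lborel)
      \<le> (\<integral>\<^sup>+t\<in>{0..1}. ennreal (((1 - t) * u + t * v) powr (1 - p)) \<partial>lborel)"
    by (intro nn_integral_mono) (auto simp: indicator_def)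
  ultimately show ?thesis by simp
qed

lemma Mp_nonneg: "0 \<le> Mp p u v"
  unfolding Mp_def set_lebesgue_integral_def by (intro integral_nonneg_AE) auto

lemma measurable_Mp [measurable]:
  assumes [measurable]: "m \<in> borel_measurable M" "n \<in> borel_measurable M"
  shows "(\<lambda>x. Mp p (m x) (n x)) \<in> borel_measurable M"
  unfolding Mp_def set_lebesgue_integral_def by measurable

lemma Mp_eq:
  fixes u v :: real
  assumes uv: "0 < u" "0 < v" "u \<noteq> v"
  shows "Mp p u v = (if p = 2 then ln (v / u) / (v - u)
                     else (v powr (2 - p) - u powr (2 - p)) / ((2 - p) * (v - u)))"
proof -
  let ?w = "\<lambda>t. (1 - t) * u + t * v"
  \<comment> \<open>A primitive found by substituting the interpolation, whose derivative in
    \<open>t\<close> is \<open>v - u\<close>. For \<open>p = 2\<close> the exponent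
    \<open>1 - p\<close> is \<open>-1\<close>, hence the logarithm.\<close>
  define P where "P t = (if p = 2 then ln (?w t) / (v - u)
    else ?w t powr (2 - p) / ((2 - p) * (v - u)))" for t
  have "Mp p u v = P 1 - P 0"
    unfolding Mp_def set_lebesgue_integral_def real_scaleR_def
    unfolding mult.commute[of "indicator _ _"]
  proof (rule integral_FTC_Icc_real)
    fix t :: real assume "0 \<le> t" "t \<le> 1"
    then have w: "0 < ?w t" using interpolation_pos[of u v t] uv by simp
    show "(P has_real_derivative ?w t powr (1 - p)) (at t)"
    proof (cases "p = 2")
      case True
      have "((\<lambda>t. ln (?w t) / (v - u)) has_real_derivative (1 / ?w t * (v - u)) / (v - u)) (at t)"
        by (intro DERIV_cdivide DERIV_chain2[OF DERIV_ln_divide])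
          (use w in \<open>auto intro!: derivative_eq_intros\<close>)
      then show ?thesis
        unfolding P_def using True uv w by (simp add: powr_minus_divide)
    next
      case False
      have "((\<lambda>t. ?w t powr (2 - p) / ((2 - p) * (v - u))) has_real_derivative
          ((2 - p) * ?w t powr (2 - p - 1) * (v - u)) / ((2 - p) * (v - u))) (at t)"
        by (intro DERIV_cdivide DERIV_fun_powr) (use w in \<open>auto intro!: derivative_eq_intros\<close>)
      then show ?thesis
        unfolding P_def using False uv by simp
    qed
    show "isCont (\<lambda>t. ?w t powr (1 - p)) t"
      using w by (auto intro!: continuous_intros)
  qed simp
  then show ?thesis
    using uv by (simp add: P_def ln_div diff_divide_distrib)
qed

subsection \<open>Mixtures and test functions\<close>

text \<open>\<open>measure_of\<close> falls back to a zero measure when its set function is not a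
  measure. Here the set function agrees on all Borel sets with \<open>emeasure ?D\<close>, so the
  fallback does not occur.\<close>

lemma mix_measure_density:
  fixes m n :: "real \<Rightarrow> real"
  assumes [measurable]: "m \<in> borel_measurable borel" "n \<in> borel_measurable borel"
    and nonneg: "\<And>x. 0 \<le> m x" "\<And>x. 0 \<le> n x" and t: "t \<in> {0..1}"
  shows "mix_measure t (density lborel (\<lambda>x. ennreal (m x))) (density lborel (\<lambda>x. ennreal (n x)))
    = density lborel (\<lambda>x. ennreal ((1 - t) * m x + t * n x))" (is "mix_measure t ?M ?N = ?D")
proof -
  have eq: "ennreal (1 - t) * emeasure ?M A + ennreal t * emeasure ?N A = emeasure ?D A"
    if [measurable]: "A \<in> sets borel" for A
  proof -
    have "emeasure ?D A = (\<integral>\<^sup>+x. ennreal (1 - t) * (ennreal (m x) * indicator A x)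
        + ennreal t * (ennreal (n x) * indicator A x) \<partial>lborel)"
      using t nonneg by (auto simp: emeasure_density ennreal_mult' ennreal_plus
          indicator_def intro!: nn_integral_cong)
    then show ?thesis
      by (simp add: emeasure_density nn_integral_add nn_integral_cmult)
  qed
  have "mix_measure t ?M ?N = measure_of (space ?D) (sets ?D) (emeasure ?D)"
    unfolding mix_measure_def space_density sets_density sets_lborel space_lborel
  proof (rule measure_of_eq)
    show "sets borel \<subseteq> Pow (space borel)" by (rule sets.space_closed)
    fix A :: "real set" assume "A \<in> sigma_sets (space borel) (sets borel)"
    then have "A \<in> sets borel" by (simp only: sets.sigma_sets_eq)
    then show "ennreal (1 - t) * emeasure ?M A + ennreal t * emeasure ?N A = emeasure ?D A"
      by (rule eq)
  qed
  then show ?thesis by (simp only: measure_of_of_measure)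
qed

text \<open>\<open>ennreal\<close> sends negative numbers to \<open>0\<close>, so the two
  nonnegative integrals are those of the positive and the negative part, both finite here.\<close>

lemma extended_integral_integrable:
  fixes g :: "'a \<Rightarrow> real"
  assumes g: "integrable M g"
  shows "extended_integral M g = ereal (\<integral>x. g x \<partial>M)"
proof -
  have "(\<integral>\<^sup>+x. ennreal (g x) \<partial>M) = ennreal (\<integral>x. max 0 (g x) \<partial>M)"
    "(\<integral>\<^sup>+x. ennreal (- g x) \<partial>M) = ennreal (\<integral>x. max 0 (- g x) \<partial>M)"
    using g by (subst nn_integral_eq_integral[symmetric]; simp)+
  moreover have "0 \<le> (\<integral>x. max 0 (g x) \<partial>M)" "0 \<le> (\<integral>x. max 0 (- g x) \<partial>M)"
    by simp_all
  moreover have "(\<integral>x. g x \<partial>M) = (\<integral>x. max 0 (g x) - max 0 (- g x) \<partial>M)"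
    by (intro Bochner_Integration.integral_cong) auto
  ultimately show ?thesis
    using g by (simp add: extended_integral_def enn2ereal_ennreal)
qed

section \<open>Test functions: derivatives, growth, measurability\<close>

lemma C12b_has_derivative:
  assumes "\<phi> \<in> C12b" "t \<in> {0<..<1}"
  shows "((\<lambda>s. \<phi> s x) has_real_derivative d_t \<phi> t x) (at t)"
    and "((\<lambda>y. \<phi> t y) has_real_derivative d_x \<phi> t x) (at x)"
    and "((\<lambda>y. d_x \<phi> t y) has_real_derivative d_x (d_x \<phi>) t x) (at x)"
proof -
  have "(\<lambda>s. \<phi> s x) field_differentiable at t" "(\<lambda>y. \<phi> t y) field_differentiable at x"
    "(\<lambda>y. d_x \<phi> t y) field_differentiable at x"
    using assms unfolding C12b_def by blast+
  then show "((\<lambda>s. \<phi> s x) has_real_derivative d_t \<phi> t x) (at t)"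
    "((\<lambda>y. \<phi> t y) has_real_derivative d_x \<phi> t x) (at x)"
    "((\<lambda>y. d_x \<phi> t y) has_real_derivative d_x (d_x \<phi>) t x) (at x)"
    unfolding DERIV_deriv_iff_field_differentiable[symmetric]
    by (simp_all only: d_t_def d_x_def[of \<phi> t x, symmetric] d_x_def[of "d_x \<phi>"])
qed

lemma continuous_on_slice:
  assumes "continuous_on (T \<times> UNIV) (\<lambda>(t, x). g t x)" "t \<in> T"
  shows "continuous_on UNIV (\<lambda>x. g t x)"
proof -
  have "continuous_on UNIV (\<lambda>x. case (t, x) of (t, x) \<Rightarrow> g t x)"
    by (rule continuous_on_compose2[OF assms(1)]) (use assms(2) in \<open>auto intro!: continuous_intros\<close>)
  then show ?thesis by simp
qed

lemma C12b_continuous: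
  assumes "\<phi> \<in> C12b"
  shows "t \<in> {0..1} \<Longrightarrow> continuous_on UNIV (\<lambda>x. \<phi> t x)"
    and "continuous_on {0..1} (\<lambda>t. \<phi> t x)"
    and "t \<in> {0<..<1} \<Longrightarrow> continuous_on UNIV (\<lambda>x. d_t \<phi> t x)"
    and "t \<in> {0<..<1} \<Longrightarrow> continuous_on UNIV (\<lambda>x. d_x (d_x \<phi>) t x)"
proof -
  have c: "continuous_on ({0..1} \<times> UNIV) (\<lambda>(t, x). \<phi> t x)"
    "continuous_on ({0<..<1} \<times> UNIV) (\<lambda>(t, x). d_t \<phi> t x)"
    "continuous_on ({0<..<1} \<times> UNIV) (\<lambda>(t, x). d_x (d_x \<phi>) t x)"
    using assms unfolding C12b_def by auto
  show "t \<in> {0..1} \<Longrightarrow> continuous_on UNIV (\<lambda>x. \<phi> t x)"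
    by (rule continuous_on_slice[OF c(1)])
  show "t \<in> {0<..<1} \<Longrightarrow> continuous_on UNIV (\<lambda>x. d_t \<phi> t x)"
    by (rule continuous_on_slice[OF c(2)])
  show "t \<in> {0<..<1} \<Longrightarrow> continuous_on UNIV (\<lambda>x. d_x (d_x \<phi>) t x)"
    by (rule continuous_on_slice[OF c(3)])
  have "continuous_on {0..1} (\<lambda>t. case (t, x) of (t, x) \<Rightarrow> \<phi> t x)"
    by (rule continuous_on_compose2[OF c(1)]) (auto intro!: continuous_intros)
  then show "continuous_on {0..1} (\<lambda>t. \<phi> t x)" by simp
qed

lemma C12b_bounds:
  assumes "\<phi> \<in> C12b"
  obtains B where "\<And>t x. t \<in> {0<..<1} \<Longrightarrow> \<bar>d_t \<phi> t x\<bar> \<le> B"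
    and "\<And>t x. t \<in> {0<..<1} \<Longrightarrow> \<bar>d_x (d_x \<phi>) t x\<bar> \<le> B"
proof -
  have "bounded ((\<lambda>(t, x). d_t \<phi> t x) ` ({0<..<1} \<times> UNIV))"
    and "bounded ((\<lambda>(t, x). d_x (d_x \<phi>) t x) ` ({0<..<1} \<times> UNIV))"
    using assms unfolding C12b_def by auto
  then obtain B1 B2 where
    "\<forall>z\<in>(\<lambda>(t, x). d_t \<phi> t x) ` ({0<..<1} \<times> UNIV). norm z \<le> B1"
    "\<forall>z\<in>(\<lambda>(t, x). d_x (d_x \<phi>) t x) ` ({0<..<1} \<times> UNIV). norm z \<le> B2"
    unfolding bounded_iff by blast
  then have "\<bar>d_t \<phi> t x\<bar> \<le> max B1 B2" "\<bar>d_x (d_x \<phi>) t x\<bar> \<le> max B1 B2" if "t \<in> {0<..<1}" for t x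
    using that by (force simp: le_max_iff_disj)+
  then show thesis using that by blast
qed

text \<open>Spatial derivatives are controlled only at interior times, so Taylor's formula is
  applied at time \<open>1/2\<close>. The bound on \<open>d_t \<phi>\<close> then carries the growth
  to all times, including \<open>0\<close> and \<open>1\<close>.\<close>

lemma C12b_quadratic_growth:
  assumes \<phi>: "\<phi> \<in> C12b"
  obtains C where "\<And>t x. t \<in> {0..1} \<Longrightarrow> \<bar>\<phi> t x\<bar> \<le> C * (1 + x\<^sup>2)"
proof -
  obtain B where B: "\<And>t x. t \<in> {0<..<1} \<Longrightarrow> \<bar>d_t \<phi> t x\<bar> \<le> B"
    "\<And>t x. t \<in> {0<..<1} \<Longrightarrow> \<bar>d_x (d_x \<phi>) t x\<bar> \<le> B"
    using C12b_bounds[OF \<phi>] by blast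
  let ?h = "1/2 :: real"
  have h: "?h \<in> {0<..<1}" by simp
  have "0 \<le> B" using B(1)[OF h, of 0] by linarith
  define A where "A = \<bar>\<phi> ?h 0\<bar> + \<bar>d_x \<phi> ?h 0\<bar> + B"
  have A: "\<bar>\<phi> ?h x\<bar> \<le> A * (1 + x\<^sup>2)" for x
    unfolding A_def
    by (rule quadratic_growth[OF C12b_has_derivative(2,3)[OF \<phi> h] C12b_continuous(4)[OF \<phi> h] B(2)[OF h]])
  \<comment> \<open>The mean value theorem asks only for continuity at the end points, so
    \<open>s = 0\<close> and \<open>t = 1\<close> are allowed.\<close>
  have lip: "\<bar>\<phi> t x - \<phi> s x\<bar> \<le> B" if "0 \<le> s" "s < t" "t \<le> 1" for s t x
  proof -
    have "\<exists>l z. s < z \<and> z < t \<and> ((\<lambda>r. \<phi> r x) has_real_derivative l) (at z)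
        \<and> \<phi> t x - \<phi> s x = (t - s) * l"
    proof (rule MVT[OF \<open>s < t\<close>])
      show "continuous_on {s..t} (\<lambda>r. \<phi> r x)"
        by (rule continuous_on_subset[OF C12b_continuous(2)[OF \<phi>]]) (use that in auto)
      show "(\<lambda>r. \<phi> r x) differentiable (at z)" if "s < z" "z < t" for z
        using C12b_has_derivative(1)[OF \<phi>, of z x] that \<open>0 \<le> s\<close> \<open>t \<le> 1\<close>
        by (auto simp: real_differentiable_def)
    qed
    then obtain l z where z: "s < z" "z < t" "((\<lambda>r. \<phi> r x) has_real_derivative l) (at z)"
      "\<phi> t x - \<phi> s x = (t - s) * l" by blast
    have z01: "z \<in> {0<..<1}" using z that by auto
    have "l = d_t \<phi> z x"
      using z(3) C12b_has_derivative(1)[OF \<phi> z01] by (rule DERIV_unique)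
    then have "\<bar>\<phi> t x - \<phi> s x\<bar> = (t - s) * \<bar>d_t \<phi> z x\<bar>"
      using z(4) that by (simp add: abs_mult)
    also have "\<dots> \<le> 1 * B"
      by (intro mult_mono B(1) z01) (use that in auto)
    finally show ?thesis by simp
  qed
  have "\<bar>\<phi> t x\<bar> \<le> (A + B) * (1 + x\<^sup>2)" if "t \<in> {0..1}" for t x
  proof -
    have "\<bar>\<phi> t x - \<phi> ?h x\<bar> \<le> B"
    proof (cases "t = ?h")
      case True
      show ?thesis unfolding True using \<open>0 \<le> B\<close> by simp
    next
      case False
      then show ?thesis
        using lip[of t ?h x] lip[of ?h t x] that
        by (cases t ?h rule: linorder_cases) (auto simp: abs_minus_commute)
    qed
    moreover have "B \<le> B * (1 + x\<^sup>2)" using \<open>0 \<le> B\<close> by (simp add: algebra_simps)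
    ultimately show ?thesis using A[of x] unfolding distrib_right[of A] by linarith
  qed
  then show thesis using that by blast
qed

text \<open>The values of \<open>\<phi>\<close> at times outside \<open>{0..1}\<close> are
  arbitrary, so joint measurability is asserted after a cutoff to the open time interval, where
  \<open>\<phi>\<close> and \<open>d_t \<phi>\<close> are continuous.\<close>

lemma C12b_measurable:
  assumes "\<phi> \<in> C12b"
  shows "(\<lambda>z. indicator {0<..<1} (fst z) * \<phi> (fst z) (snd z)) \<in> borel_measurable (lborel \<Otimes>\<^sub>M lborel)"
    and "(\<lambda>z. indicator {0<..<1} (fst z) * d_t \<phi> (fst z) (snd z)) \<in> borel_measurable (lborel \<Otimes>\<^sub>M lborel)"
proof -
  have *: "(\<lambda>z. indicator {0<..<1} (fst z) * g (fst z) (snd z)) \<in> borel_measurable (lborel \<Otimes>\<^sub>M lborel)"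
    if g: "continuous_on ({0<..<1} \<times> UNIV) (\<lambda>(t, x). g t x)" for g :: "real \<Rightarrow> real \<Rightarrow> real"
  proof -
    have "(\<lambda>z. indicator ({0<..<1} \<times> UNIV) z *\<^sub>R (case z of (t, x) \<Rightarrow> g t x))
        \<in> borel_measurable (borel :: (real \<times> real) measure)"
      by (intro borel_measurable_continuous_on_indicator g borel_open open_Times) auto
    then show ?thesis
      by (simp add: lborel_prod split_beta' indicator_times)
  qed
  have "continuous_on ({0..1} \<times> UNIV) (\<lambda>(t, x). \<phi> t x)"
    and d: "continuous_on ({0<..<1} \<times> UNIV) (\<lambda>(t, x). d_t \<phi> t x)"
    using assms unfolding C12b_def by auto
  from this(1) have "continuous_on ({0<..<1} \<times> UNIV) (\<lambda>(t, x). \<phi> t x)"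
    by (rule continuous_on_subset) auto
  then show "(\<lambda>z. indicator {0<..<1} (fst z) * \<phi> (fst z) (snd z)) \<in> borel_measurable (lborel \<Otimes>\<^sub>M lborel)"
    by (rule *)
  show "(\<lambda>z. indicator {0<..<1} (fst z) * d_t \<phi> (fst z) (snd z)) \<in> borel_measurable (lborel \<Otimes>\<^sub>M lborel)"
    by (rule *[OF d])
qed

text \<open>The slab has length \<open>1\<close> in time, so a time-independent integrable majorant
  remains integrable on it.\<close>

lemma integrable_pair_slab:
  fixes D :: "real \<Rightarrow> real"
  assumes D: "integrable lborel D"
  shows "integrable (lborel \<Otimes>\<^sub>M lborel) (\<lambda>(t, x). indicator {0<..<1::real} t * D x)"
proof (rule lborel_pair.Fubini_integrable)
  have [measurable]: "D \<in> borel_measurable borel" using D by simp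
  show "(\<lambda>(t, x). indicator {0<..<1::real} t * D x) \<in> borel_measurable (lborel \<Otimes>\<^sub>M lborel)"
    by measurable
  show "integrable lborel (\<lambda>t. \<integral>x. norm (case (t, x) of (t, x) \<Rightarrow> indicator {0<..<1::real} t * D x) \<partial>lborel)"
    by (simp add: abs_mult)
qed (use D in simp)

lemma integrable_mult_bounded:
  fixes g k :: "real \<Rightarrow> real"
  assumes k: "integrable M k" and [measurable]: "g \<in> borel_measurable M" and B: "\<And>x. \<bar>g x\<bar> \<le> B"
  shows "integrable M (\<lambda>x. g x * k x)"
proof (rule Bochner_Integration.integrable_bound)
  show "integrable M (\<lambda>x. B * k x)" using k by simp
  have [measurable]: "k \<in> borel_measurable M" using k by simp
  show "(\<lambda>x. g x * k x) \<in> borel_measurable M" by measurable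
  have "\<bar>g x\<bar> \<le> \<bar>B\<bar>" for x using B[of x] by linarith
  then show "AE x in M. norm (g x * k x) \<le> norm (B * k x)"
    by (intro always_eventually) (simp add: abs_mult mult_right_mono)
qed

subsection \<open>The interpolating curve\<close>

text \<open>Convex order enters here through the equality of the means; nonnegativity of the
  potential is a separate hypothesis of the lemmas on the coefficient.\<close>

locale balanced_pair =
  fixes m n :: "real \<Rightarrow> real"
  assumes m_borel [measurable]: "m \<in> borel_measurable borel" and m_pos: "\<And>x. 0 < m x"
    and n_borel [measurable]: "n \<in> borel_measurable borel" and n_pos: "\<And>x. 0 < n x"
    and m_integrable: "integrable lborel m" and n_integrable: "integrable lborel n"
    and m_second_moment: "integrable lborel (\<lambda>x. x\<^sup>2 * m x)"
    and n_second_moment: "integrable lborel (\<lambda>x. x\<^sup>2 * n x)"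
    and m_mass: "(\<integral>x. m x \<partial>lborel) = 1" and n_mass: "(\<integral>x. n x \<partial>lborel) = 1"
    and means: "(\<integral>x. x * m x \<partial>lborel) = (\<integral>x. x * n x \<partial>lborel)"
begin

sublocale balanced_density "\<lambda>x. n x - m x"
proof
  have "integrable lborel (\<lambda>x. x * m x)" "integrable lborel (\<lambda>x. x * n x)"
    by (rule integrable_quadratic_growth[of _ _ 1];
        simp add: m_integrable m_second_moment n_integrable n_second_moment abs_le_one_plus_square)+
  then show "(\<integral>x. x * (n x - m x) \<partial>lborel) = 0"
    using means by (simp add: right_diff_distrib)
qed (use m_integrable n_integrable m_second_moment n_second_moment m_mass n_mass
     in \<open>simp_all add: right_diff_distrib\<close>)

definition interpolant :: "real \<Rightarrow> real \<Rightarrow> real" where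
  "interpolant t x = (1 - t) * m x + t * n x"

lemma interpolant_gt_0: "t \<in> {0..1} \<Longrightarrow> 0 < interpolant t x"
  unfolding interpolant_def by (intro interpolation_pos m_pos n_pos)

lemma interpolant_le: "t \<in> {0..1} \<Longrightarrow> interpolant t x \<le> m x + n x"
  unfolding interpolant_def using m_pos[of x] n_pos[of x]
  by (intro add_mono mult_left_le_one_le) auto

lemma measurable_interpolant [measurable]:
  assumes [measurable]: "g \<in> borel_measurable M" "k \<in> borel_measurable M"
  shows "(\<lambda>z. interpolant (g z) (k z)) \<in> borel_measurable M"
  unfolding interpolant_def by measurable

lemma interpolant_integrable: "integrable lborel (interpolant t)"
  unfolding interpolant_def[abs_def] using m_integrable n_integrable by simp

lemma integral_interpolant:
  assumes "integrable lborel (\<lambda>x. g x * m x)" "integrable lborel (\<lambda>x. g x * n x)"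
  shows "integrable lborel (\<lambda>x. g x * interpolant t x)"
    and "(\<integral>x. g x * interpolant t x \<partial>lborel)
      = (1 - t) * (\<integral>x. g x * m x \<partial>lborel) + t * (\<integral>x. g x * n x \<partial>lborel)"
proof -
  have eq: "(\<lambda>x. g x * interpolant t x) = (\<lambda>x. (1 - t) * (g x * m x) + t * (g x * n x))"
    by (simp add: interpolant_def fun_eq_iff algebra_simps)
  show "integrable lborel (\<lambda>x. g x * interpolant t x)"
    unfolding eq using assms by simp
  show "(\<integral>x. g x * interpolant t x \<partial>lborel)
      = (1 - t) * (\<integral>x. g x * m x \<partial>lborel) + t * (\<integral>x. g x * n x \<partial>lborel)"
    unfolding eq using assms by simp
qed

text \<open>The mixture in density form. For times in \<open>{0..1}\<close> the interpolant is
  positive, so \<open>ennreal\<close> truncates nothing.\<close>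

definition curve :: "real \<Rightarrow> real measure" where
  "curve t = density lborel (\<lambda>x. ennreal (interpolant t x))"

lemma curve_borel [measurable_cong]: "sets (curve t) = sets borel"
  by (simp add: curve_def)

lemma integral_curve:
  assumes [measurable]: "g \<in> borel_measurable borel" and t: "t \<in> {0..1}"
  shows "(\<integral>x. g x \<partial>curve t) = (\<integral>x. g x * interpolant t x \<partial>lborel)"
  unfolding curve_def using interpolant_gt_0[OF t]
  by (subst integral_density) (auto simp: mult.commute less_imp_le)

lemma curve_P2:
  assumes t: "t \<in> {0..1}"
  shows "curve t \<in> P2"
proof -
  have pos: "0 \<le> interpolant t x" for x using interpolant_gt_0[OF t] by (simp add: less_imp_le)
  have "(\<integral>x. interpolant t x \<partial>lborel) = 1"
    using integral_interpolant(2)[of "\<lambda>_. 1" t] by (simp add: m_integrable n_integrable m_mass n_mass)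
  then have "emeasure (curve t) (space (curve t)) = 1"
    using pos by (simp add: curve_def emeasure_density nn_integral_eq_integral interpolant_integrable)
  then have "prob_space (curve t)" by (rule prob_spaceI)
  moreover have "integrable (curve t) (\<lambda>x. x\<^sup>2)"
    using integral_interpolant(1)[OF m_second_moment n_second_moment, of t] pos
    unfolding curve_def by (subst integrable_density) (auto simp: mult.commute)
  ultimately show ?thesis by (simp add: P2_def curve_borel)
qed

text \<open>By linearity the integral is an affine function of \<open>t\<close> on
  \<open>{0..1}\<close>.\<close>

lemma integral_curve_continuous:
  assumes [measurable]: "g \<in> borel_measurable borel"
    and "integrable lborel (\<lambda>x. g x * m x)" "integrable lborel (\<lambda>x. g x * n x)"
  shows "continuous_on {0..1} (\<lambda>t. \<integral>x. g x \<partial>curve t)"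
proof -
  have "continuous_on {0..1} (\<lambda>t. (1 - t) * (\<integral>x. g x * m x \<partial>lborel) + t * (\<integral>x. g x * n x \<partial>lborel))"
    by (intro continuous_intros)
  then show ?thesis
    by (rule continuous_on_eq) (simp add: integral_curve integral_interpolant(2) assms)
qed

text \<open>It suffices to check the generating sets of the topology. Their preimages are preimages
  of open sets under the affine functions of the previous lemma.\<close>

lemma continuous_map_curve: "continuous_map (top_of_set {0..1}) P2_topology curve"
  unfolding P2_topology_def
proof (rule continuous_on_generated_topo)
  have preimage: "openin (top_of_set {0..1}) (curve -` {\<mu> \<in> P2. (\<integral>x. g x \<partial>\<mu>) \<in> U} \<inter> {0..1})"
    if "continuous_on {0..1} (\<lambda>t. \<integral>x. g x \<partial>curve t)" "open U" for g :: "real \<Rightarrow> real" and U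
  proof -
    have "curve -` {\<mu> \<in> P2. (\<integral>x. g x \<partial>\<mu>) \<in> U} \<inter> {0..1}
        = {0..1} \<inter> (\<lambda>t. \<integral>x. g x \<partial>curve t) -` U"
      using curve_P2 by auto
    then show ?thesis using continuous_openin_preimage_gen[OF that] by simp
  qed
  fix V
  assume "V \<in> {{\<mu> \<in> P2. (\<integral>x. g x \<partial>\<mu>) \<in> U} |g U.
         continuous_on UNIV (g :: real \<Rightarrow> real) \<and> bounded (range g) \<and> open (U :: real set)}
      \<union> {{\<mu> \<in> P2. (\<integral>x. x\<^sup>2 \<partial>\<mu>) \<in> U} |U. open (U :: real set)}"
  then show "openin (top_of_set {0..1}) (curve -` V \<inter> topspace (top_of_set {0..1}))"
  proof (elim UnE CollectE exE conjE)
    fix g :: "real \<Rightarrow> real" and U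
    assume V: "V = {\<mu> \<in> P2. (\<integral>x. g x \<partial>\<mu>) \<in> U}" and g: "continuous_on UNIV g"
      "bounded (range g)" and U: "open U"
    from g(1) have [measurable]: "g \<in> borel_measurable borel"
      by (rule borel_measurable_continuous_onI)
    from g(2) obtain B where B: "\<And>x. \<bar>g x\<bar> \<le> B" by (auto simp: bounded_iff)
    have "0 \<le> B" using B[of 0] by linarith
    \<comment> \<open>Bounded functions grow at most quadratically, so both families of functionals
      are handled by the same lemma.\<close>
    then have growth: "\<bar>g x\<bar> \<le> B * (1 + x\<^sup>2)" for x
      using B[of x] by (simp add: distrib_left add_increasing2)
    have "continuous_on {0..1} (\<lambda>t. \<integral>x. g x \<partial>curve t)"
      by (rule integral_curve_continuous[OF _
            integrable_quadratic_growth[OF _ _ m_integrable m_second_moment growth]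
            integrable_quadratic_growth[OF _ _ n_integrable n_second_moment growth]]) measurable
    from preimage[OF this U]
    show "openin (top_of_set {0..1}) (curve -` V \<inter> topspace (top_of_set {0..1}))"
      by (simp add: V)
  next
    fix U :: "real set"
    assume V: "V = {\<mu> \<in> P2. (\<integral>x. x\<^sup>2 \<partial>\<mu>) \<in> U}" and U: "open U"
    have "continuous_on {0..1} (\<lambda>t. \<integral>x. x\<^sup>2 \<partial>curve t)"
      by (rule integral_curve_continuous) (simp_all add: m_second_moment n_second_moment)
    from preimage[OF this U]
    show "openin (top_of_set {0..1}) (curve -` V \<inter> topspace (top_of_set {0..1}))"
      by (simp add: V)
  qed
next
  show "curve ` topspace (top_of_set {0..1}) \<subseteq> \<Union> ({{\<mu> \<in> P2. (\<integral>x. g x \<partial>\<mu>) \<in> U} |g U.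
         continuous_on UNIV (g :: real \<Rightarrow> real) \<and> bounded (range g) \<and> open (U :: real set)}
      \<union> {{\<mu> \<in> P2. (\<integral>x. x\<^sup>2 \<partial>\<mu>) \<in> U} |U. open (U :: real set)})" (is "_ \<subseteq> \<Union> (?S \<union> ?T)")
  \<comment> \<open>With \<open>U = UNIV\<close> the second family contains all of
    \<open>P2\<close>, so the generating sets cover the curve.\<close>
  proof (rule order_trans)
    show "curve ` topspace (top_of_set {0..1}) \<subseteq> {\<mu> \<in> P2. (\<integral>x. x\<^sup>2 \<partial>\<mu>) \<in> UNIV}"
      using curve_P2 by auto
    have "{\<mu> \<in> P2. (\<integral>x. x\<^sup>2 \<partial>\<mu>) \<in> UNIV} \<in> ?T"
      by (intro CollectI exI[of _ UNIV] conjI refl open_UNIV)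
    then show "{\<mu> \<in> P2. (\<integral>x. x\<^sup>2 \<partial>\<mu>) \<in> UNIV} \<subseteq> \<Union> (?S \<union> ?T)"
      by (intro Union_upper UnI2)
  qed
qed

section \<open>The weak formulation\<close>

text \<open>The density of the curve cancels the denominator of the coefficient, leaving the
  potential integrated against the second derivative of the test function; this is then moved onto
  \<open>n - m\<close>.\<close>

lemma integral_curve_test_function:
  assumes \<phi>: "\<phi> \<in> C12b" and t: "t \<in> {0<..<1}"
  shows "(\<integral>x. d_t \<phi> t x + 1/2 * (2 * potential x / interpolant t x) * d_x (d_x \<phi>) t x \<partial>curve t)
    = (\<integral>x. d_t \<phi> t x * interpolant t x + \<phi> t x * (n x - m x) \<partial>lborel)"
proof -
  obtain B where B: "\<And>t x. t \<in> {0<..<1} \<Longrightarrow> \<bar>d_t \<phi> t x\<bar> \<le> B"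
    "\<And>t x. t \<in> {0<..<1} \<Longrightarrow> \<bar>d_x (d_x \<phi>) t x\<bar> \<le> B"
    using C12b_bounds[OF \<phi>] by blast
  obtain C where C: "\<And>t x. t \<in> {0..1} \<Longrightarrow> \<bar>\<phi> t x\<bar> \<le> C * (1 + x\<^sup>2)"
    using C12b_quadratic_growth[OF \<phi>] by blast
  have t': "t \<in> {0..1}" using t by auto
  note [measurable] = C12b_continuous(1)[OF \<phi> t', THEN borel_measurable_continuous_onI]
    C12b_continuous(3)[OF \<phi> t, THEN borel_measurable_continuous_onI]
    C12b_continuous(4)[OF \<phi> t, THEN borel_measurable_continuous_onI]
  have i1: "integrable lborel (\<lambda>x. d_t \<phi> t x * interpolant t x)"
    by (rule integrable_mult_bounded[OF interpolant_integrable _ B(1)[OF t]]) measurable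
  have i2: "integrable lborel (\<lambda>x. d_x (d_x \<phi>) t x * potential x)"
    by (rule integrable_mult_bounded[OF potential_integrable _ B(2)[OF t]]) measurable
  have i3: "integrable lborel (\<lambda>x. \<phi> t x * (n x - m x))"
    by (rule integrable_quadratic_growth[OF _ _ h_integrable h_second_moment C[OF t']]) measurable
  have "(\<integral>x. d_t \<phi> t x + 1/2 * (2 * potential x / interpolant t x) * d_x (d_x \<phi>) t x \<partial>curve t)
      = (\<integral>x. d_t \<phi> t x * interpolant t x + d_x (d_x \<phi>) t x * potential x \<partial>lborel)"
    using interpolant_gt_0[OF t'] by (subst integral_curve[OF _ t'])
      (auto intro!: Bochner_Integration.integral_cong simp: less_imp_neq[symmetric] field_simps)
  also have "\<dots> = (\<integral>x. d_t \<phi> t x * interpolant t x \<partial>lborel) + (\<integral>x. \<phi> t x * (n x - m x) \<partial>lborel)"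
    using integral_potential_second_derivative[OF C12b_has_derivative(2,3)[OF \<phi> t]
        C12b_continuous(4)[OF \<phi> t] B(2)[OF t]] i1 i2
    by (simp add: mult.commute)
  also have "\<dots> = (\<integral>x. d_t \<phi> t x * interpolant t x + \<phi> t x * (n x - m x) \<partial>lborel)"
    using i1 i3 by simp
  finally show ?thesis .
qed

text \<open>The integrand is the time derivative of \<open>\<phi> t x * interpolant t x\<close>.
  This product is differentiable inside the interval and merely continuous up to its ends, which the
  fundamental theorem for the gauge integral permits.\<close>

lemma integral_time_derivative:
  assumes \<phi>: "\<phi> \<in> C12b"
    and int: "integrable lborel (\<lambda>t. indicator {0<..<1} t * (d_t \<phi> t x * interpolant t x + \<phi> t x * (n x - m x)))"
  shows "(\<integral>t. indicator {0<..<1} t * (d_t \<phi> t x * interpolant t x + \<phi> t x * (n x - m x)) \<partial>lborel)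
    = \<phi> 1 x * n x - \<phi> 0 x * m x"
proof -
  let ?D = "\<lambda>t. d_t \<phi> t x * interpolant t x + \<phi> t x * (n x - m x)"
  have "(?D has_integral (\<phi> 1 x * interpolant 1 x - \<phi> 0 x * interpolant 0 x)) {0..1}"
  proof (rule fundamental_theorem_of_calculus_interior)
    show "continuous_on {0..1} (\<lambda>t. \<phi> t x * interpolant t x)"
      unfolding interpolant_def by (intro continuous_intros C12b_continuous(2)[OF \<phi>])
    fix t :: real assume "t \<in> {0<..<1}"
    then have "((\<lambda>t. \<phi> t x * interpolant t x) has_real_derivative ?D t) (at t)"
      unfolding interpolant_def
      by (auto intro!: derivative_eq_intros C12b_has_derivative(1)[OF \<phi>] simp: algebra_simps)
    then show "((\<lambda>t. \<phi> t x * interpolant t x) has_vector_derivative ?D t) (at t)"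
      by (simp add: has_real_derivative_iff_has_vector_derivative)
  qed simp
  then have "(?D has_integral (\<phi> 1 x * n x - \<phi> 0 x * m x)) {0<..<1}"
    unfolding has_integral_Icc_iff_Ioo by (simp add: interpolant_def[of 0] interpolant_def[of 1])
  then have "((\<lambda>t. indicator {0<..<1} t * ?D t) has_integral (\<phi> 1 x * n x - \<phi> 0 x * m x)) UNIV"
    unfolding has_integral_restrict_UNIV[of _ ?D, symmetric]
    by (rule has_integral_eq[rotated]) (simp add: indicator_def)
  \<comment> \<open>An integrable function has its Lebesgue integral as gauge integral, so the two
    values coincide.\<close>
  with has_integral_integral_lborel[OF int] show ?thesis
    by (rule has_integral_unique)
qed

lemma weak_formulation:
  assumes \<phi>: "\<phi> \<in> C12b"
  shows "(LBINT t:{0<..<1}. (\<integral>x. d_t \<phi> t x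
      + 1/2 * (2 * potential x / interpolant t x) * d_x (d_x \<phi>) t x \<partial>curve t))
    = (\<integral>x. \<phi> 1 x \<partial>curve 1) - (\<integral>x. \<phi> 0 x \<partial>curve 0)"
proof -
  obtain B where B: "\<And>t x. t \<in> {0<..<1} \<Longrightarrow> \<bar>d_t \<phi> t x\<bar> \<le> B"
    by (rule C12b_bounds[OF \<phi>]) (rule that)
  obtain C where C: "\<And>t x. t \<in> {0..1} \<Longrightarrow> \<bar>\<phi> t x\<bar> \<le> C * (1 + x\<^sup>2)"
    using C12b_quadratic_growth[OF \<phi>] by blast
  \<comment> \<open>The cutoff is built in, so \<open>G\<close> can be studied on the whole
    plane.\<close>
  define G where
    "G t x = indicator {0<..<1} t * (d_t \<phi> t x * interpolant t x + \<phi> t x * (n x - m x))" for t x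
  \<comment> \<open>A majorant of \<open>G\<close> independent of time: the interpolant is at most
    \<open>m x + n x\<close>, and \<open>B\<close> and \<open>C\<close> are uniform in time.\<close>
  define D where "D x = \<bar>B\<bar> * (m x + n x) + C * (1 + x\<^sup>2) * \<bar>n x - m x\<bar>" for x
  have "0 \<le> C" using C[of 0 0] by simp
  have "integrable lborel (\<lambda>x. (C * (1 + x\<^sup>2)) * (n x - m x))"
    by (rule integrable_quadratic_growth[OF _ _ h_integrable h_second_moment, of _ C])
      (use \<open>0 \<le> C\<close> in auto)
  then have "integrable lborel (\<lambda>x. \<bar>(C * (1 + x\<^sup>2)) * (n x - m x)\<bar>)"
    by (rule integrable_abs)
  then have "integrable lborel D"
    unfolding D_def using m_integrable n_integrable \<open>0 \<le> C\<close> by (simp add: abs_mult)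
  then have "integrable (lborel \<Otimes>\<^sub>M lborel) (\<lambda>(t, x). indicator {0<..<1::real} t * D x)"
    by (rule integrable_pair_slab)
  then have G_int: "integrable (lborel \<Otimes>\<^sub>M lborel) (\<lambda>(t, x). G t x)"
  proof (rule Bochner_Integration.integrable_bound)
    note [measurable] = C12b_measurable[OF \<phi>]
    \<comment> \<open>The cutoff is attached to each factor coming from \<open>\<phi>\<close>, the
      form in which measurability is known.\<close>
    have "(\<lambda>(t, x). G t x) = (\<lambda>z. (indicator {0<..<1} (fst z) * d_t \<phi> (fst z) (snd z)) * interpolant (fst z) (snd z)
        + (indicator {0<..<1} (fst z) * \<phi> (fst z) (snd z)) * (n (snd z) - m (snd z)))"
      by (auto simp: G_def algebra_simps)
    also have "\<dots> \<in> borel_measurable (lborel \<Otimes>\<^sub>M lborel)" by measurable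
    finally show "(\<lambda>(t, x). G t x) \<in> borel_measurable (lborel \<Otimes>\<^sub>M lborel)" .
    have "\<bar>G t x\<bar> \<le> \<bar>indicator {0<..<1} t * D x\<bar>" for t x
    proof (cases "t \<in> {0<..<1}")
      case True
      then have t: "t \<in> {0..1}" by auto
      have "\<bar>d_t \<phi> t x\<bar> \<le> \<bar>B\<bar>" using B[OF True, of x] by linarith
      then have "\<bar>d_t \<phi> t x\<bar> * interpolant t x \<le> \<bar>B\<bar> * (m x + n x)"
        using interpolant_le[OF t] interpolant_gt_0[OF t, of x] by (intro mult_mono) auto
      moreover have "\<bar>\<phi> t x\<bar> * \<bar>n x - m x\<bar> \<le> C * (1 + x\<^sup>2) * \<bar>n x - m x\<bar>"
        by (intro mult_right_mono C t) simp
      moreover have "\<bar>G t x\<bar> \<le> \<bar>d_t \<phi> t x\<bar> * interpolant t x + \<bar>\<phi> t x\<bar> * \<bar>n x - m x\<bar>"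
        using True interpolant_gt_0[OF t, of x] 
          abs_triangle_ineq[of "d_t \<phi> t x * interpolant t x" "\<phi> t x * (n x - m x)"]
        by (simp add: G_def abs_mult)
      ultimately have "\<bar>G t x\<bar> \<le> D x" unfolding D_def by linarith
      then show ?thesis using True by simp
    qed (simp add: G_def)
    then show "AE z in lborel \<Otimes>\<^sub>M lborel. norm (case z of (t, x) \<Rightarrow> G t x)
        \<le> norm (case z of (t, x) \<Rightarrow> indicator {0<..<1} t * D x)"
      by (intro always_eventually) auto
  qed
  have c: "integrable lborel (\<lambda>x. \<phi> t x * g x)"
    if "t \<in> {0..1}" and [measurable]: "g \<in> borel_measurable borel"
      and "integrable lborel g" "integrable lborel (\<lambda>x. x\<^sup>2 * g x)" for t g
    using that C12b_continuous(1)[OF \<phi> that(1), THEN borel_measurable_continuous_onI]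
    by (intro integrable_quadratic_growth[OF _ _ _ _ C]) auto
  have "(LBINT t:{0<..<1}. (\<integral>x. d_t \<phi> t x
      + 1/2 * (2 * potential x / interpolant t x) * d_x (d_x \<phi>) t x \<partial>curve t))
    = (\<integral>t. (\<integral>x. G t x \<partial>lborel) \<partial>lborel)"
    unfolding set_lebesgue_integral_def
  proof (intro Bochner_Integration.integral_cong refl)
    fix t :: real
    show "indicator {0<..<1} t *\<^sub>R (\<integral>x. d_t \<phi> t x
        + 1/2 * (2 * potential x / interpolant t x) * d_x (d_x \<phi>) t x \<partial>curve t) = (\<integral>x. G t x \<partial>lborel)"
    proof (cases "t \<in> {0<..<1}")
      case True
      then show ?thesis unfolding integral_curve_test_function[OF \<phi> True] by (simp add: G_def)
    qed (simp add: G_def)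
  qed
  also have "\<dots> = (\<integral>x. (\<integral>t. G t x \<partial>lborel) \<partial>lborel)"
    by (rule lborel_pair.Fubini_integral[OF G_int, symmetric])
  also have "\<dots> = (\<integral>x. \<phi> 1 x * n x - \<phi> 0 x * m x \<partial>lborel)"
  \<comment> \<open>The time integral is evaluated for those \<open>x\<close> at which
    \<open>G\<close> is integrable in time; by Fubini these are almost all.\<close>
  proof (rule integral_cong_AE)
    have [measurable]: "(\<lambda>(t, x). G t x) \<in> borel_measurable (lborel \<Otimes>\<^sub>M lborel)"
      using G_int by (rule borel_measurable_integrable)
    have [measurable]: "(\<lambda>(x, t). G t x) \<in> borel_measurable (lborel \<Otimes>\<^sub>M lborel)"
      using measurable_pair_swap[OF \<open>(\<lambda>(t, x). G t x) \<in> _\<close>] by simp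
    show "(\<lambda>x. \<integral>t. G t x \<partial>lborel) \<in> borel_measurable lborel" by measurable
    note [measurable] = C12b_continuous(1)[OF \<phi>, of 1, THEN borel_measurable_continuous_onI]
      C12b_continuous(1)[OF \<phi>, of 0, THEN borel_measurable_continuous_onI]
    show "(\<lambda>x. \<phi> 1 x * n x - \<phi> 0 x * m x) \<in> borel_measurable lborel" by simp
    show "AE x in lborel. (\<integral>t. G t x \<partial>lborel) = \<phi> 1 x * n x - \<phi> 0 x * m x"
      using lborel_pair.AE_integrable_snd[OF G_int]
      by eventually_elim (simp add: G_def integral_time_derivative[OF \<phi>])
  qed
  also have "\<dots> = (\<integral>x. \<phi> 1 x * n x \<partial>lborel) - (\<integral>x. \<phi> 0 x * m x \<partial>lborel)"
    by (intro Bochner_Integration.integral_diff c)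
      (simp_all add: m_integrable n_integrable m_second_moment n_second_moment)
  also have "\<dots> = (\<integral>x. \<phi> 1 x \<partial>curve 1) - (\<integral>x. \<phi> 0 x \<partial>curve 0)"
    using C12b_continuous(1)[OF \<phi>, THEN borel_measurable_continuous_onI]
    by (simp add: integral_curve interpolant_def)
  finally show ?thesis .
qed

section \<open>Integrals of powers of the coefficient\<close>

text \<open>One power of the interpolant comes from the density and \<open>p\<close> powers are
  divided out. Only the factor with exponent \<open>1 - p\<close> depends on time, which is the
  origin of \<open>Mp\<close>.\<close>

lemma nn_integral_coefficient:
  assumes nonneg: "\<And>x. 0 \<le> potential x" and t: "t \<in> {0..1}"
  shows "(\<integral>\<^sup>+x. ennreal (\<bar>2 * potential x / interpolant t x\<bar> powr p) \<partial>curve t)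
    = (\<integral>\<^sup>+x. ennreal (2 powr p * potential x powr p) * ennreal (interpolant t x powr (1 - p)) \<partial>lborel)"
proof -
  have "interpolant t x * \<bar>2 * potential x / interpolant t x\<bar> powr p
      = 2 powr p * potential x powr p * interpolant t x powr (1 - p)" for x
    using interpolant_gt_0[OF t, of x] nonneg[of x]
    by (simp add: powr_divide powr_mult powr_diff abs_mult field_simps)
  then show ?thesis
    unfolding curve_def using interpolant_gt_0[OF t]
    by (subst nn_integral_density)
      (auto intro!: nn_integral_cong simp: ennreal_mult'[symmetric] less_imp_le)
qed

text \<open>For \<open>p = 1\<close> the interpolant cancels, so the inner integral is twice the
  integral of the potential at every time.\<close>

lemma nn_integral_coefficient_finite:
  assumes nonneg: "\<And>x. 0 \<le> potential x"
  shows "(\<integral>\<^sup>+t\<in>{0<..<1}. (\<integral>\<^sup>+x. ennreal \<bar>2 * potential x / interpolant t x\<bar> \<partial>curve t) \<partial>lborel) < \<infinity>"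
proof -
  have "(\<integral>\<^sup>+x. ennreal \<bar>2 * potential x / interpolant t x\<bar> \<partial>curve t) = ennreal (\<integral>x. 2 * potential x \<partial>lborel)"
    (is "?L t = ?R") if t: "t \<in> {0<..<1}" for t
  proof -
    have "t \<in> {0..1}" using t by auto
    from nn_integral_coefficient[OF nonneg this, of 1] interpolant_gt_0[OF this]
    have "(\<integral>\<^sup>+x. ennreal \<bar>2 * potential x / interpolant t x\<bar> \<partial>curve t)
        = (\<integral>\<^sup>+x. ennreal (2 * potential x) \<partial>lborel)"
      by (simp add: nonneg less_imp_neq[symmetric])
    then show ?thesis
      using potential_integrable nonneg by (simp add: nn_integral_eq_integral)
  qed
  then have eq: "?L t * indicator {0<..<1} t = ?R * indicator {0<..<1} t" for t
    by (simp only: indicator_def) simp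
  have "(\<integral>\<^sup>+t\<in>{0<..<1}. ?L t \<partial>lborel) = (\<integral>\<^sup>+t\<in>{0<..<1::real}. ?R \<partial>lborel)"
    by (intro nn_integral_cong) (rule eq)
  then show ?thesis by (simp add: nn_integral_cmult ennreal_mult_less_top)
qed

text \<open>Jensen's inequality is applied to the Taylor kernel instead of the convolution kernel,
  so that a later integration in \<open>x\<close> runs only between \<open>0\<close> and
  \<open>y\<close>.\<close>

lemma potential_powr_le:
  assumes "1 \<le> p"
  shows "ennreal (\<bar>potential x\<bar> powr p) \<le> ennreal ((\<integral>x. \<bar>n x - m x\<bar> \<partial>lborel) powr (p - 1))
    * (\<integral>\<^sup>+y. ennreal (taylor_kernel x y powr p * \<bar>n y - m y\<bar>) \<partial>lborel)"
  unfolding potential_eq_taylor_kernel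
  by (rule powr_integral_le[OF _ h_integrable taylor_kernel_integrable taylor_kernel_nonneg assms]) measurable

text \<open>For fixed \<open>y\<close> the kernel lives between \<open>0\<close> and
  \<open>y\<close>, where it is at most \<open>\<bar>x - y\<bar>\<close>. The absolute value removes
  the sign that the orientation gives for \<open>y < 0\<close>.\<close>

lemma taylor_kernel_oriented_integral:
  "(\<integral>\<^sup>+x. ennreal (Mp p (m x) (n x) * taylor_kernel x y powr p) \<partial>lborel)
    \<le> e2ennreal \<bar>oriented_integral (\<lambda>x. ennreal (Mp p (m x) (n x) * \<bar>x - y\<bar> powr p)) 0 y\<bar>"
proof -
  have abs_uminus_enn: "\<bar>- enn2ereal z\<bar> = enn2ereal z" for z
    using enn2ereal_nonneg[of z] by simp
  let ?g = "\<lambda>x. ennreal (Mp p (m x) (n x) * \<bar>x - y\<bar> powr p)"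
  have "(\<integral>\<^sup>+x. ennreal (Mp p (m x) (n x) * taylor_kernel x y powr p) \<partial>lborel)
      \<le> (if 0 \<le> y then (\<integral>\<^sup>+x\<in>{0..y}. ?g x \<partial>lborel) else (\<integral>\<^sup>+x\<in>{y..0}. ?g x \<partial>lborel))"
    by (auto intro!: nn_integral_mono simp: taylor_kernel_def indicator_def max_def)
  then show ?thesis
    by (simp add: oriented_integral_def abs_uminus_enn split: if_splits)
qed

lemma nn_integral_coefficient_powr_le:
  assumes nonneg: "\<And>x. 0 \<le> potential x" and p: "1 \<le> p"
  shows "(\<integral>\<^sup>+t\<in>{0<..<1}. (\<integral>\<^sup>+x. ennreal (\<bar>2 * potential x / interpolant t x\<bar> powr p) \<partial>curve t) \<partial>lborel)
    \<le> ennreal (2 powr p * (\<integral>x. \<bar>n x - m x\<bar> \<partial>lborel) powr (p - 1))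
      * (\<integral>\<^sup>+x. ennreal \<bar>n x - m x\<bar>
          * e2ennreal \<bar>oriented_integral (\<lambda>y. ennreal (Mp p (m y) (n y) * \<bar>y - x\<bar> powr p)) 0 x\<bar> \<partial>lborel)"
proof -
  define H where "H = (\<integral>x. \<bar>n x - m x\<bar> \<partial>lborel)"
  have "(\<integral>\<^sup>+t\<in>{0<..<1}. (\<integral>\<^sup>+x. ennreal (\<bar>2 * potential x / interpolant t x\<bar> powr p) \<partial>curve t) \<partial>lborel)
      = (\<integral>\<^sup>+t. (\<integral>\<^sup>+x. ennreal (2 powr p * potential x powr p)
          * (ennreal (interpolant t x powr (1 - p)) * indicator {0<..<1} t) \<partial>lborel) \<partial>lborel)"
  proof (intro nn_integral_cong)
    fix t :: real
    show "(\<integral>\<^sup>+x. ennreal (\<bar>2 * potential x / interpolant t x\<bar> powr p) \<partial>curve t) * indicator {0<..<1} t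
        = (\<integral>\<^sup>+x. ennreal (2 powr p * potential x powr p)
          * (ennreal (interpolant t x powr (1 - p)) * indicator {0<..<1} t) \<partial>lborel)"
    proof (cases "t \<in> {0<..<1}")
      case True
      then have "t \<in> {0..1}" by auto
      from nn_integral_coefficient[OF nonneg this, of p] True show ?thesis by simp
    qed simp
  qed
  \<comment> \<open>First exchange: for fixed \<open>x\<close> the time integral reaches the power
    of the interpolant and is bounded by \<open>Mp\<close>.\<close>
  also have "\<dots> = (\<integral>\<^sup>+x. (\<integral>\<^sup>+t. ennreal (2 powr p * potential x powr p)
          * (ennreal (interpolant t x powr (1 - p)) * indicator {0<..<1} t) \<partial>lborel) \<partial>lborel)"
    by (rule lborel_pair.Fubini') measurable
  also have "\<dots> \<le> (\<integral>\<^sup>+x. ennreal (2 powr p * H powr (p - 1))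
        * (\<integral>\<^sup>+y. ennreal \<bar>n y - m y\<bar> * ennreal (Mp p (m x) (n x) * taylor_kernel x y powr p) \<partial>lborel) \<partial>lborel)"
  proof (rule nn_integral_mono)
    fix x
    let ?K = "\<integral>\<^sup>+y. ennreal (taylor_kernel x y powr p * \<bar>n y - m y\<bar>) \<partial>lborel"
    have "(\<integral>\<^sup>+t. ennreal (2 powr p * potential x powr p)
          * (ennreal (interpolant t x powr (1 - p)) * indicator {0<..<1} t) \<partial>lborel)
        = ennreal (2 powr p * potential x powr p)
          * (\<integral>\<^sup>+t\<in>{0<..<1}. ennreal (interpolant t x powr (1 - p)) \<partial>lborel)"
      by (rule nn_integral_cmult) measurable
    also have "\<dots> \<le> ennreal (2 powr p) * ennreal (potential x powr p) * ennreal (Mp p (m x) (n x))"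
      unfolding interpolant_def
      by (intro mult_mono nn_integral_interpolation_powr m_pos n_pos) (auto simp: ennreal_mult')
    also have "\<dots> \<le> ennreal (2 powr p) * (ennreal (H powr (p - 1)) * ?K) * ennreal (Mp p (m x) (n x))"
      using potential_powr_le[OF p, of x] nonneg[of x]
      by (intro mult_right_mono mult_left_mono) (auto simp: H_def)
    also have "\<dots> = ennreal (2 powr p * H powr (p - 1)) * (ennreal (Mp p (m x) (n x)) * ?K)"
      by (simp add: ennreal_mult' mult_ac)
    also have "ennreal (Mp p (m x) (n x)) * ?K
        = (\<integral>\<^sup>+y. ennreal (Mp p (m x) (n x)) * ennreal (taylor_kernel x y powr p * \<bar>n y - m y\<bar>) \<partial>lborel)"
      by (rule nn_integral_cmult[symmetric]) measurable
    also have "\<dots> = (\<integral>\<^sup>+y. ennreal \<bar>n y - m y\<bar> * ennreal (Mp p (m x) (n x) * taylor_kernel x y powr p) \<partial>lborel)"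
      by (simp add: ennreal_mult'[symmetric] Mp_nonneg mult_ac)
    finally show "(\<integral>\<^sup>+t. ennreal (2 powr p * potential x powr p)
          * (ennreal (interpolant t x powr (1 - p)) * indicator {0<..<1} t) \<partial>lborel)
      \<le> ennreal (2 powr p * H powr (p - 1))
        * (\<integral>\<^sup>+y. ennreal \<bar>n y - m y\<bar> * ennreal (Mp p (m x) (n x) * taylor_kernel x y powr p) \<partial>lborel)" .
  qed
  also have "\<dots> = ennreal (2 powr p * H powr (p - 1)) * (\<integral>\<^sup>+x. (\<integral>\<^sup>+y. ennreal \<bar>n y - m y\<bar>
        * ennreal (Mp p (m x) (n x) * taylor_kernel x y powr p) \<partial>lborel) \<partial>lborel)"
    by (rule nn_integral_cmult) measurable
  \<comment> \<open>Second exchange: with \<open>y\<close> outside, the inner integral becomes an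
    oriented integral from \<open>0\<close> to \<open>y\<close>.\<close>
  also have "(\<integral>\<^sup>+x. (\<integral>\<^sup>+y. ennreal \<bar>n y - m y\<bar>
        * ennreal (Mp p (m x) (n x) * taylor_kernel x y powr p) \<partial>lborel) \<partial>lborel)
      = (\<integral>\<^sup>+y. (\<integral>\<^sup>+x. ennreal \<bar>n y - m y\<bar>
        * ennreal (Mp p (m x) (n x) * taylor_kernel x y powr p) \<partial>lborel) \<partial>lborel)"
    by (rule lborel_pair.Fubini') measurable
  also have "\<dots> = (\<integral>\<^sup>+y. ennreal \<bar>n y - m y\<bar>
        * (\<integral>\<^sup>+x. ennreal (Mp p (m x) (n x) * taylor_kernel x y powr p) \<partial>lborel) \<partial>lborel)"
    by (intro nn_integral_cong nn_integral_cmult) measurable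
  also have "ennreal (2 powr p * H powr (p - 1)) * \<dots>
      \<le> ennreal (2 powr p * H powr (p - 1)) * (\<integral>\<^sup>+y. ennreal \<bar>n y - m y\<bar>
        * e2ennreal \<bar>oriented_integral (\<lambda>x. ennreal (Mp p (m x) (n x) * \<bar>x - y\<bar> powr p)) 0 y\<bar> \<partial>lborel)"
    by (intro mult_left_mono nn_integral_mono taylor_kernel_oriented_integral) auto
  finally show ?thesis by (simp add: H_def)
qed

text \<open>The data are prescribed only for times in \<open>{0..1}\<close>, so each clause is
  transferred from \<open>curve\<close> and the explicit coefficient by a congruence on that
  interval.\<close>

lemma fokker_planck_curve:
  assumes nonneg: "\<And>x. 0 \<le> potential x"
    and \<rho>: "\<And>t. t \<in> {0..1} \<Longrightarrow> \<rho> t = curve t"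
    and a: "\<And>t x. t \<in> {0..1} \<Longrightarrow> a t x = 2 * potential x / interpolant t x"
  shows "fokker_planck \<rho> a"
  unfolding fokker_planck_def
proof (intro conjI ballI allI)
  have 01: "t \<in> {0..1}" if "t \<in> {0<..<1}" for t :: real using that by auto
  show "continuous_map (top_of_set {0..1}) P2_topology \<rho>"
    by (rule continuous_map_eq[OF continuous_map_curve]) (simp add: \<rho>)
  have "(\<lambda>(t, x). 2 * potential x / interpolant t x) \<in> borel_measurable (borel \<Otimes>\<^sub>M borel)"
    by measurable
  then have "(\<lambda>(t, x). 2 * potential x / interpolant t x)
      \<in> borel_measurable (restrict_space borel ({0<..<1} \<times> UNIV))"
    by (intro measurable_restrict_space1) (simp add: borel_prod)
  then show "(\<lambda>(t, x). a t x) \<in> borel_measurable (restrict_space borel ({0<..<1} \<times> UNIV))"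
    by (rule measurable_cong[THEN iffD1, rotated]) (auto simp: space_restrict_space a)
  show "0 \<le> a t x" if "t \<in> {0<..<1}" for t x
    using nonneg[of x] interpolant_gt_0[OF 01[OF that], of x]
    unfolding a[OF 01[OF that]] by simp
  have "(\<integral>\<^sup>+t\<in>{0<..<1}. (\<integral>\<^sup>+x. ennreal \<bar>a t x\<bar> \<partial>\<rho> t) \<partial>lborel)
      = (\<integral>\<^sup>+t\<in>{0<..<1}. (\<integral>\<^sup>+x. ennreal \<bar>2 * potential x / interpolant t x\<bar> \<partial>curve t) \<partial>lborel)"
    by (intro nn_integral_cong) (auto simp: \<rho> a indicator_def)
  then show "(\<integral>\<^sup>+t\<in>{0<..<1}. (\<integral>\<^sup>+x. ennreal \<bar>a t x\<bar> \<partial>\<rho> t) \<partial>lborel) < \<infinity>"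
    using nn_integral_coefficient_finite[OF nonneg] by simp
  fix \<phi> assume \<phi>: "\<phi> \<in> C12b"
  have "(LBINT t:{0<..<1}. (\<integral>x. d_t \<phi> t x + 1/2 * a t x * d_x (d_x \<phi>) t x \<partial>\<rho> t))
      = (LBINT t:{0<..<1}. (\<integral>x. d_t \<phi> t x
          + 1/2 * (2 * potential x / interpolant t x) * d_x (d_x \<phi>) t x \<partial>curve t))"
    by (rule set_lebesgue_integral_cong) (auto simp: \<rho> a)
  with weak_formulation[OF \<phi>]
  show "(LBINT t:{0<..<1}. (\<integral>x. d_t \<phi> t x + 1/2 * a t x * d_x (d_x \<phi>) t x \<partial>\<rho> t))
      = (\<integral>x. \<phi> 1 x \<partial>\<rho> 1) - (\<integral>x. \<phi> 0 x \<partial>\<rho> 0)"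
    by (simp add: \<rho>)
qed

end

section \<open>Consequences of convex order for the densities\<close>

lemma P2_density:
  fixes m :: "real \<Rightarrow> real"
  assumes [measurable]: "m \<in> borel_measurable borel" and nonneg: "\<And>x. 0 \<le> m x"
    and P2: "density lborel (\<lambda>x. ennreal (m x)) \<in> P2"
  shows "integrable lborel m" and "(\<integral>x. m x \<partial>lborel) = 1" and "integrable lborel (\<lambda>x. x\<^sup>2 * m x)"
proof -
  interpret prob_space "density lborel (\<lambda>x. ennreal (m x))"
    using P2 by (simp add: P2_def)
  have "(\<integral>\<^sup>+x. ennreal (m x) \<partial>lborel) = ennreal 1"
    using emeasure_space_1 by (simp add: emeasure_density)
  from nn_integral_eq_integrable[THEN iffD1, OF _ _ _ this] nonneg
  show "integrable lborel m" "(\<integral>x. m x \<partial>lborel) = 1" by auto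
  have "integrable (density lborel (\<lambda>x. ennreal (m x))) (\<lambda>x. x\<^sup>2)"
    using P2 by (simp add: P2_def)
  then show "integrable lborel (\<lambda>x. x\<^sup>2 * m x)"
    using nonneg by (subst (asm) integrable_density) (auto simp: mult.commute)
qed

text \<open>Both extended integrals are finite under these integrability assumptions, so the
  comparison descends to the reals.\<close>

lemma convex_order_density:
  fixes m n g :: "real \<Rightarrow> real"
  assumes [measurable]: "m \<in> borel_measurable borel" "n \<in> borel_measurable borel" "g \<in> borel_measurable borel"
    and nonneg: "\<And>x. 0 \<le> m x" "\<And>x. 0 \<le> n x"
    and cx: "convex_order (density lborel (\<lambda>x. ennreal (m x))) (density lborel (\<lambda>x. ennreal (n x)))"
    and g: "convex_on UNIV g"
    and int: "integrable lborel (\<lambda>x. g x * m x)" "integrable lborel (\<lambda>x. g x * n x)"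
  shows "(\<integral>x. g x * m x \<partial>lborel) \<le> (\<integral>x. g x * n x \<partial>lborel)"
proof -
  have eq: "extended_integral (density lborel (\<lambda>x. ennreal (k x))) g = ereal (\<integral>x. g x * k x \<partial>lborel)"
    if [measurable]: "k \<in> borel_measurable borel" and "\<And>x. 0 \<le> k x" "integrable lborel (\<lambda>x. g x * k x)"
    for k
  proof -
    have "integrable (density lborel (\<lambda>x. ennreal (k x))) g"
      using that by (subst integrable_density) (auto simp: mult.commute)
    then have "extended_integral (density lborel (\<lambda>x. ennreal (k x))) g
        = ereal (\<integral>x. g x \<partial>density lborel (\<lambda>x. ennreal (k x)))"
      by (rule extended_integral_integrable)
    then show ?thesis
      using that by (simp add: integral_density mult.commute)
  qed
  have "extended_integral (density lborel (\<lambda>x. ennreal (m x))) g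
      \<le> extended_integral (density lborel (\<lambda>x. ennreal (n x))) g"
    using cx g by (simp add: convex_order_def)
  then show ?thesis using int nonneg by (simp add: eq)
qed

lemma convex_on_positive_part: "convex_on UNIV (\<lambda>y. max (x - y) (0::real))"
proof (rule convex_onI)
  fix t u v :: real assume "0 < t" "t < 1"
  then have "(1 - t) * (x - u) \<le> (1 - t) * max (x - u) 0" "t * (x - v) \<le> t * max (x - v) 0"
    "0 \<le> (1 - t) * max (x - u) 0" "0 \<le> t * max (x - v) 0"
    by (auto intro!: mult_left_mono)
  moreover have "x - ((1 - t) *\<^sub>R u + t *\<^sub>R v) = (1 - t) * (x - u) + t * (x - v)"
    by (simp add: algebra_simps)
  ultimately show "max (x - ((1 - t) *\<^sub>R u + t *\<^sub>R v)) 0 \<le> (1 - t) * max (x - u) 0 + t * max (x - v) 0"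
    by (intro max.boundedI) linarith+
qed simp

lemma balanced_pair_convex_order:
  fixes m n :: "real \<Rightarrow> real"
  assumes [measurable]: "m \<in> borel_measurable borel" "n \<in> borel_measurable borel"
    and pos: "\<And>x. 0 < m x" "\<And>x. 0 < n x"
    and P2: "density lborel (\<lambda>x. ennreal (m x)) \<in> P2" "density lborel (\<lambda>x. ennreal (n x)) \<in> P2"
    and cx: "convex_order (density lborel (\<lambda>x. ennreal (m x))) (density lborel (\<lambda>x. ennreal (n x)))"
  shows "balanced_pair m n" and "0 \<le> convol (\<lambda>x. max x 0) (\<lambda>x. n x - m x) x"
proof -
  have nonneg: "0 \<le> m x" "0 \<le> n x" for x using pos[of x] by (auto simp: less_imp_le)
  note mP = P2_density[OF assms(1) nonneg(1) P2(1)] and nP = P2_density[OF assms(2) nonneg(2) P2(2)]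
  have growth: "integrable lborel (\<lambda>x. g x * m x)" "integrable lborel (\<lambda>x. g x * n x)"
    if [measurable]: "g \<in> borel_measurable borel" and "\<And>x. \<bar>g x\<bar> \<le> C * (1 + x\<^sup>2)" for g C
    by (rule integrable_quadratic_growth[OF _ _ _ _ that(2)]; use mP nP in simp)+
  have le: "(\<integral>x. g x * m x \<partial>lborel) \<le> (\<integral>x. g x * n x \<partial>lborel)"
    if [measurable]: "g \<in> borel_measurable borel" and "\<And>x. \<bar>g x\<bar> \<le> C * (1 + x\<^sup>2)" "convex_on UNIV g"
    for g C
    by (rule convex_order_density[OF _ _ _ nonneg cx that(3) growth[OF _ that(2)]]) measurable
  \<comment> \<open>Both signs are convex, so the two inequalities combine to equality of the
    means.\<close>
  have "convex_on UNIV (\<lambda>x::real. x)" "convex_on UNIV (\<lambda>x::real. - x)"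
    by (auto intro!: convex_onI simp: algebra_simps)
  with le[of "\<lambda>x. x" 1] le[of "\<lambda>x. - x" 1]
  have means: "(\<integral>x. x * m x \<partial>lborel) = (\<integral>x. x * n x \<partial>lborel)"
    by (simp add: abs_le_one_plus_square)
  show "balanced_pair m n"
    by unfold_locales (use pos mP nP means in simp_all)
  \<comment> \<open>The growth constant may depend on \<open>x\<close>, which is fixed; the function
    of \<open>y\<close> is what is tested.\<close>
  have bound: "\<bar>max (x - y) 0\<bar> \<le> (1 + \<bar>x\<bar>) * (1 + y\<^sup>2)" for y
  proof -
    have "\<bar>x\<bar> \<le> \<bar>x\<bar> * (1 + y\<^sup>2)" by (simp add: distrib_left)
    then show ?thesis
      using abs_le_one_plus_square[of y] unfolding distrib_right mult_1 by linarith
  qed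
  have "convol (\<lambda>x. max x 0) (\<lambda>x. n x - m x) x
      = (\<integral>y. max (x - y) 0 * n y \<partial>lborel) - (\<integral>y. max (x - y) 0 * m y \<partial>lborel)"
    unfolding convol_def right_diff_distrib
    by (rule Bochner_Integration.integral_diff; rule growth[OF _ bound]; measurable)
  then show "0 \<le> convol (\<lambda>x. max x 0) (\<lambda>x. n x - m x) x"
    using le[OF _ bound convex_on_positive_part] by simp
qed

theorem proposition5p2:
  fixes m n f :: "real \<Rightarrow> real" and \<mu> \<nu> :: "real measure"
    and \<rho> :: "real \<Rightarrow> real measure" and a :: "real \<Rightarrow> real \<Rightarrow> real"
  assumes m_borel: "m \<in> borel_measurable borel" and m_pos: "\<And>x. m x > 0"
    and n_borel: "n \<in> borel_measurable borel" and n_pos: "\<And>x. n x > 0"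
    and mu: "\<mu> = density lborel (\<lambda>x. ennreal (m x))" and mu_P2: "\<mu> \<in> P2"
    and nu: "\<nu> = density lborel (\<lambda>x. ennreal (n x))" and nu_P2: "\<nu> \<in> P2"
    and cx: "convex_order \<mu> \<nu>"
    and f: "f = convol (\<lambda>x. max x 0) (\<lambda>x. n x - m x)"
    and rho: "\<And>t. t \<in> {0..1} \<Longrightarrow> \<rho> t = mix_measure t \<mu> \<nu>"
    and a: "\<And>t x. t \<in> {0..1} \<Longrightarrow> a t x = 2 * f x / ((1 - t) * m x + t * n x)"
  shows "(\<forall>x. 0 \<le> f x)
    \<and> fokker_planck \<rho> a
    \<and> (\<forall>p\<ge>1.
         (\<integral>\<^sup>+t\<in>{0<..<1}. (\<integral>\<^sup>+x. ennreal (\<bar>a t x\<bar> powr p) \<partial>\<rho> t) \<partial>lborel)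
         \<le> ennreal (2 powr p * (\<integral>x. \<bar>n x - m x\<bar> \<partial>lborel) powr (p - 1))
           * (\<integral>\<^sup>+x. ennreal \<bar>n x - m x\<bar>
                * e2ennreal \<bar>oriented_integral (\<lambda>y. ennreal (Mp p (m y) (n y) * \<bar>y - x\<bar> powr p)) 0 x\<bar>
              \<partial>lborel))
    \<and> (\<forall>p\<ge>1. \<forall>u>0. \<forall>v>0. u \<noteq> v \<longrightarrow>
         Mp p u v = (if p = 2 then ln (v / u) / (v - u)
                     else (v powr (2 - p) - u powr (2 - p)) / ((2 - p) * (v - u))))"
proof -
  interpret balanced_pair m n
    by (rule balanced_pair_convex_order[OF m_borel n_borel m_pos n_pos
          mu_P2[unfolded mu] nu_P2[unfolded nu] cx[unfolded mu nu]])
  have nonneg: "0 \<le> potential x" for x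
    by (rule balanced_pair_convex_order[OF m_borel n_borel m_pos n_pos
          mu_P2[unfolded mu] nu_P2[unfolded nu] cx[unfolded mu nu]])
  \<comment> \<open>From here on the mixture is replaced by its density form, to which the preceding
    lemmas apply.\<close>
  have \<rho>: "\<rho> t = curve t" if "t \<in> {0..1}" for t
    unfolding rho[OF that] mu nu curve_def interpolant_def
    by (rule mix_measure_density) (use m_pos n_pos that in \<open>auto simp: less_imp_le\<close>)
  have a': "a t x = 2 * potential x / interpolant t x" if "t \<in> {0..1}" for t x
    by (simp add: a[OF that] f interpolant_def)
  have eq: "(\<integral>\<^sup>+t\<in>{0<..<1}. (\<integral>\<^sup>+x. ennreal (\<bar>a t x\<bar> powr p) \<partial>\<rho> t) \<partial>lborel)
      = (\<integral>\<^sup>+t\<in>{0<..<1}. (\<integral>\<^sup>+x. ennreal (\<bar>2 * potential x / interpolant t x\<bar> powr p) \<partial>curve t) \<partial>lborel)"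
    for p
    by (intro nn_integral_cong) (auto simp: \<rho> a' indicator_def)
  show ?thesis
  proof (intro conjI allI impI)
    show "0 \<le> f x" for x unfolding f by (rule nonneg)
    show "fokker_planck \<rho> a" by (rule fokker_planck_curve[OF nonneg \<rho> a'])
    show "(\<integral>\<^sup>+t\<in>{0<..<1}. (\<integral>\<^sup>+x. ennreal (\<bar>a t x\<bar> powr p) \<partial>\<rho> t) \<partial>lborel)
         \<le> ennreal (2 powr p * (\<integral>x. \<bar>n x - m x\<bar> \<partial>lborel) powr (p - 1))
           * (\<integral>\<^sup>+x. ennreal \<bar>n x - m x\<bar>
                * e2ennreal \<bar>oriented_integral (\<lambda>y. ennreal (Mp p (m y) (n y) * \<bar>y - x\<bar> powr p)) 0 x\<bar>
              \<partial>lborel)" if "1 \<le> p" for p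
      unfolding eq by (rule nn_integral_coefficient_powr_le[OF nonneg that])
  qed (rule Mp_eq)
qed

end
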